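(* Let $f : B \to A$ be a Kan fibration between Kan complexes in the category of simplicial sets. Then for every ordinal $\alpha$ the canonical map $W(f)_{<\alpha} \to A$ is a Kan fibration; in particular, the canonical map $W(f) \to A$ is a Kan fibration.
   Context: For a map $f : B \to A$ in a locally cartesian closed category $\mathcal{E}$, the polynomial functor $P_f : \mathcal{E} \to \mathcal{E}$ is the composite $\mathcal{E} \xrightarrow{-\times B} \mathcal{E}/B \xrightarrow{\Pi_f} \mathcal{E}/A \xrightarrow{\Sigma_A} \mathcal{E}$, where $\Pi_f$ is right adjoint to pullback along $f$ and $\Sigma_A$ is the forgetful functor (left adjoint to taking the product with $A$). The W-type $W(f)$ is the initial $P_f$-algebra. In simplicial sets (presheaves on the simplex category $\Delta$), $W(f)$ is described concretely as follows. Put $\hat A = \{(C,a) : C \in \Delta,\ a \in A(C)\}$ and, for $(C,a) \in \hat A$, $\hat B_{(C,a)} = \{(\beta : D \to C,\ b \in B(D)) : f_D(b) = a\cdot\beta\}$, where $a \cdot \beta$ denotes restriction. Let $W(\hat f)$ be the set of well-founded trees inductively generated by: for each $(C,a)\in\hat A$ and each function $t : \hat B_{(C,a)} \to W(\hat f)$ there is a tree $\sup_{(C,a)}(t)$. (So $W(\hat f)$ is the W-type, in the category of sets, of the projection $\hat f : \sum_{(C,a)\in\hat A}\hat B_{(C,a)} \to \hat A$.) It is a simplicial set: $\sup_{(C,a)}(t)$ lies in the fibre over $C$, and for $\gamma : D \to C$ its restriction is $\sup_{(C,a)}(t)\cdot\gamma = \sup_{(D,a\cdot\gamma)}(t\cdot\gamma)$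 with $(t\cdot\gamma)(\beta,b) = t(\gamma\beta,b)$. A tree $\sup_{(C,a)}(t)$ is natural if for each $(\beta : D\to C,b)\in \hat B_{(C,a)}$ the tree $t(\beta,b)$ lies in the fibre over $D$, and for each $\delta : E \to D$ one has $t(\beta\delta,b\cdot\delta) = t(\beta,b)\cdot\delta$. The subtrees of $\sup_{(C,a)}(t)$ are that tree itself and, recursively, all subtrees of the trees $t(\beta,b)$. A tree is hereditarily natural if all its subtrees are natural. $W(f)$ is the simplicial subset of $W(\hat f)$ consisting of the hereditarily natural trees. The rank of a tree is the ordinal defined recursively by $\mathrm{rk}(\sup_{(C,a)}(t)) = \sup\{\mathrm{rk}(t(\beta,b))+1 : (\beta,b)\in\hat B_{(C,a)}\}$. For an ordinal $\alpha$, $W(f)_{<\alpha}$ is the simplicial subset $\{w \in W(f) : \mathrm{rk}(w)<\alpha\}$ of $W(f)$. The canonical map $W(f)\to A$ sends $\sup_{(C,a)}(t)$ to $a$, and $W(f)_{<\alpha}\to A$ is its restriction. *)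

theory Defs
  imports Main "HOL-Library.FuncSet"
begin

section \<open>Simplicial sets\<close>

text \<open>The object \<open>[n]\<close> of the simplex category is represented by \<open>n\<close>; an arrow
  \<open>[m] \<rightarrow> [n]\<close> is a monotone function \<open>{..m} \<rightarrow> {..n}\<close>, made unique by extensionality.\<close>

definition Delta :: "nat \<Rightarrow> nat \<Rightarrow> (nat \<Rightarrow> nat) set" where
  "Delta m n = {\<theta> \<in> {..m} \<rightarrow>\<^sub>E {..n}. mono_on {..m} \<theta>}"

text \<open>\<open>restr X m n \<theta> x\<close> is the restriction \<open>x \<cdot> \<theta>\<close> of \<open>x \<in> cells X n\<close> along
  \<open>\<theta> : [m] \<rightarrow> [n]\<close>. The source and the target of \<open>\<theta>\<close> are passed explicitly because
  they cannot be recovered from the underlying function.\<close>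

record 'a sset =
  cells :: "nat \<Rightarrow> 'a set"
  restr :: "nat \<Rightarrow> nat \<Rightarrow> (nat \<Rightarrow> nat) \<Rightarrow> 'a \<Rightarrow> 'a"

definition simplicial_set :: "'a sset \<Rightarrow> bool" where
  "simplicial_set X \<longleftrightarrow>
     (\<forall>m n. \<forall>\<theta> \<in> Delta m n. \<forall>x \<in> cells X n. restr X m n \<theta> x \<in> cells X m) \<and>
     (\<forall>n. \<forall>x \<in> cells X n. restr X n n (\<lambda>i\<in>{..n}. i) x = x) \<and>
     (\<forall>l m n. \<forall>\<phi> \<in> Delta l m. \<forall>\<theta> \<in> Delta m n. \<forall>x \<in> cells X n.
        restr X l n (compose {..l} \<theta> \<phi>) x = restr X l m \<phi> (restr X m n \<theta> x))"

definition simplicial_map :: "'a sset \<Rightarrow> 'b sset \<Rightarrow> (nat \<Rightarrow> 'a \<Rightarrow> 'b) \<Rightarrow> bool" where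
  "simplicial_map X Y h \<longleftrightarrow>
     simplicial_set X \<and> simplicial_set Y \<and>
     (\<forall>n. \<forall>x \<in> cells X n. h n x \<in> cells Y n) \<and>
     (\<forall>m n. \<forall>\<theta> \<in> Delta m n. \<forall>x \<in> cells X n.
        h m (restr X m n \<theta> x) = restr Y m n \<theta> (h n x))"

definition simplex :: "nat \<Rightarrow> (nat \<Rightarrow> nat) sset" where
  "simplex n = \<lparr>cells = (\<lambda>m. Delta m n), restr = (\<lambda>l m \<phi> \<theta>. compose {..l} \<theta> \<phi>)\<rparr>"

text \<open>The horn is the union of the faces of the standard \<open>n\<close>-simplex opposite to the
  vertices \<open>j \<noteq> k\<close>; an arrow into \<open>[n]\<close> lies in the \<open>j\<close>-th face iff it omits \<open>j\<close>.\<close>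

definition horn :: "nat \<Rightarrow> nat \<Rightarrow> (nat \<Rightarrow> nat) sset" where
  "horn n k = (simplex n)
     \<lparr>cells := (\<lambda>m. {\<theta> \<in> Delta m n. \<exists>j \<in> {..n}. j \<noteq> k \<and> j \<notin> \<theta> ` {..m}})\<rparr>"

definition terminal_sset :: "unit sset" where
  "terminal_sset = \<lparr>cells = (\<lambda>n. UNIV), restr = (\<lambda>m n \<theta> x. x)\<rparr>"

definition kan_fibration :: "'a sset \<Rightarrow> 'b sset \<Rightarrow> (nat \<Rightarrow> 'a \<Rightarrow> 'b) \<Rightarrow> bool" where
  "kan_fibration X Y p \<longleftrightarrow>
     simplicial_map X Y p \<and>
     (\<forall>n k u v. 1 \<le> n \<longrightarrow> k \<le> n \<longrightarrow>
        simplicial_map (horn n k) X u \<longrightarrow> simplicial_map (simplex n) Y v \<longrightarrow>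
        (\<forall>m. \<forall>\<theta> \<in> cells (horn n k) m. p m (u m \<theta>) = v m \<theta>) \<longrightarrow>
        (\<exists>w. simplicial_map (simplex n) X w \<and>
             (\<forall>m. \<forall>\<theta> \<in> cells (horn n k) m. w m \<theta> = u m \<theta>) \<and>
             (\<forall>m. \<forall>\<theta> \<in> cells (simplex n) m. p m (w m \<theta>) = v m \<theta>)))"

definition kan_complex :: "'a sset \<Rightarrow> bool" where
  "kan_complex X \<longleftrightarrow> kan_fibration X terminal_sset (\<lambda>_ _. ())"


section \<open>Trees\<close>

text \<open>\<open>Node n a t\<close> is the tree with label \<open>([n], a)\<close>. A pair consisting of an arrow
  \<open>\<beta> : [m] \<rightarrow> [n]\<close> and some \<open>b\<close> is represented by the triple \<open>(m, \<beta>, b)\<close>. The branching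
  \<open>t\<close> is a partial function, so that functions whose domain is a set depending on
  \<open>n\<close> and \<open>a\<close> have a unique representation.\<close>

datatype ('a, 'b) tree =
  Node (fibre: nat) (root: 'a) (branch: "nat \<times> (nat \<Rightarrow> nat) \<times> 'b \<rightharpoonup> ('a, 'b) tree")

definition Bhat :: "'a sset \<Rightarrow> 'b sset \<Rightarrow> (nat \<Rightarrow> 'b \<Rightarrow> 'a) \<Rightarrow> nat \<Rightarrow> 'a
    \<Rightarrow> (nat \<times> (nat \<Rightarrow> nat) \<times> 'b) set" where
  "Bhat A B f n a =
     {(m, \<beta>, b). \<beta> \<in> Delta m n \<and> b \<in> cells B m \<and> f m b = restr A m n \<beta> a}"

inductive_set What :: "'a sset \<Rightarrow> 'b sset \<Rightarrow> (nat \<Rightarrow> 'b \<Rightarrow> 'a) \<Rightarrow> ('a, 'b) tree set"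
  for A B f where
  "a \<in> cells A n \<Longrightarrow> dom t = Bhat A B f n a \<Longrightarrow> \<forall>u \<in> ran t. u \<in> What A B f
     \<Longrightarrow> Node n a t \<in> What A B f"

text \<open>\<open>tree_restr A B f m n \<gamma> w\<close> is the restriction of \<open>w\<close>, a tree in the fibre over
  \<open>[n]\<close>, along \<open>\<gamma> : [m] \<rightarrow> [n]\<close>.\<close>

definition tree_restr :: "'a sset \<Rightarrow> 'b sset \<Rightarrow> (nat \<Rightarrow> 'b \<Rightarrow> 'a) \<Rightarrow> nat \<Rightarrow> nat
    \<Rightarrow> (nat \<Rightarrow> nat) \<Rightarrow> ('a, 'b) tree \<Rightarrow> ('a, 'b) tree" where
  "tree_restr A B f m n \<gamma> w =
     (let a = restr A m n \<gamma> (root w)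
      in Node m a ((\<lambda>(l, \<beta>, b). branch w (l, compose {..l} \<gamma> \<beta>, b)) |` Bhat A B f m a))"

definition natural :: "'a sset \<Rightarrow> 'b sset \<Rightarrow> (nat \<Rightarrow> 'b \<Rightarrow> 'a) \<Rightarrow> ('a, 'b) tree \<Rightarrow> bool" where
  "natural A B f w \<longleftrightarrow>
     (\<forall>(m, \<beta>, b) \<in> Bhat A B f (fibre w) (root w).
        fibre (the (branch w (m, \<beta>, b))) = m \<and>
        (\<forall>l. \<forall>\<delta> \<in> Delta l m.
           the (branch w (l, compose {..l} \<beta> \<delta>, restr B l m \<delta> b)) =
           tree_restr A B f l m \<delta> (the (branch w (m, \<beta>, b)))))"

inductive subtree :: "('a, 'b) tree \<Rightarrow> ('a, 'b) tree \<Rightarrow> bool" where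
  "subtree w w"
| "u \<in> ran t \<Longrightarrow> subtree v u \<Longrightarrow> subtree v (Node n a t)"

definition hereditarily_natural :: "'a sset \<Rightarrow> 'b sset \<Rightarrow> (nat \<Rightarrow> 'b \<Rightarrow> 'a)
    \<Rightarrow> ('a, 'b) tree \<Rightarrow> bool" where
  "hereditarily_natural A B f w \<longleftrightarrow> (\<forall>v. subtree v w \<longrightarrow> natural A B f v)"

definition W :: "'a sset \<Rightarrow> 'b sset \<Rightarrow> (nat \<Rightarrow> 'b \<Rightarrow> 'a) \<Rightarrow> ('a, 'b) tree sset" where
  "W A B f = \<lparr>cells = (\<lambda>n. {w \<in> What A B f. fibre w = n \<and> hereditarily_natural A B f w}),
              restr = tree_restr A B f\<rparr>"


section \<open>Rank\<close>

text \<open>An element of a well-ordered type \<open>'o\<close> stands for the ordinal given by the order type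
  of its strict initial segment, and every ordinal arises in this way from a suitable \<open>'o\<close>.
  Ordinals that are too large to be represented in \<open>'o\<close> are identified with each other,
  as \<open>None\<close>; they are larger than every \<open>\<alpha> :: 'o\<close>, so that comparing a rank with
  \<open>\<alpha>\<close> is unaffected.\<close>

definition ord_succ :: "'o::wellorder option \<Rightarrow> 'o option" where
  "ord_succ r = (case r of None \<Rightarrow> None
     | Some x \<Rightarrow> if \<exists>y. x < y then Some (LEAST y. x < y) else None)"

definition ord_sup :: "'o::wellorder option set \<Rightarrow> 'o option" where
  "ord_sup S =
     (if \<exists>x. \<forall>r \<in> S. \<exists>y \<le> x. r = Some y
      then Some (LEAST x. \<forall>r \<in> S. \<exists>y \<le> x. r = Some y) else None)"

primrec rank :: "('a, 'b) tree \<Rightarrow> 'o::wellorder option" where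
  "rank (Node n a t) = ord_sup (ord_succ ` ran (map_option rank \<circ> t))"

definition W_less :: "'a sset \<Rightarrow> 'b sset \<Rightarrow> (nat \<Rightarrow> 'b \<Rightarrow> 'a) \<Rightarrow> 'o::wellorder
    \<Rightarrow> ('a, 'b) tree sset" where
  "W_less A B f \<alpha> = (W A B f)
     \<lparr>cells := (\<lambda>n. {w \<in> cells (W A B f) n. \<exists>\<rho>. rank w = Some \<rho> \<and> \<rho> < \<alpha>})\<rparr>"

end

theory Submission
  imports Defs
begin

text \<open>Let \<open>nxt T\<close> be the set of trees all of whose branches lie in \<open>T\<close>. Both \<open>W A B f\<close> and
  each \<open>W_less A B f \<alpha>\<close> arise from the empty set by iterating \<open>nxt\<close> and taking unions of
  chains. Unions of chains preserve Kan fibrations over \<open>A\<close> because horns are finite. For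
  \<open>nxt\<close>, a horn filling over a simplex \<open>\<Delta>\<^sup>n \<rightarrow> A\<close> is an extension, along the pullback
  \<open>E\<^sub>\<Lambda> \<rightarrow> E\<close> of the horn inclusion to \<open>E = \<Delta>\<^sup>n \<times>\<^sub>A B\<close>, of a map into the Kan complex \<open>T\<close>.
  Such extensions exist: \<open>\<Delta>\<^sup>n\<close> deforms into the horn by a homotopy that preserves the horn,
  this deformation lifts to \<open>E\<close> along the fibration, and extending along it only uses
  fillings of open boxes \<open>K \<times> {e} \<union> L \<times> \<Delta>\<^sup>1\<close> in cylinders \<open>K \<times> \<Delta>\<^sup>1\<close>. The latter are
  built from horn fillings, one prism \<open>\<Delta>\<^sup>m \<times> \<Delta>\<^sup>1\<close> at a time.\<close>

section \<open>The simplex category\<close>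

text \<open>The labels of the children of a tree are not constrained by the simplex of
  \<open>A\<close> below the tree. So the extension problem for \<open>T\<close> has no base, and
  its solution needs \<open>T\<close> to be a Kan complex rather than a fibration over
  \<open>A\<close>; this comes from composing with the map from the Kan complex \<open>A\<close> to
  the point. As E is not a simplex, horns of it are not at hand, and a homotopy supplies two open
  boxes instead: the one at the end where the homotopy is the identity is filled along
  \<open>f\<close> and lifts the homotopy to E, the one at the opposite end is filled in
  \<open>T\<close>. Vertices can only be pushed up to \<open>k\<close> if \<open>k = n\<close>, and
  only down if \<open>k = 0\<close>; the direction decides which end is which, so boxes at both ends
  0 and 1 are treated.\<close>

lemma DeltaI:
  assumes "\<And>i. i \<le> m \<Longrightarrow> \<theta> i \<le> n" and "\<And>i j. i \<le> j \<Longrightarrow> j \<le> m \<Longrightarrow> \<theta> i \<le> \<theta> j"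
    and "\<And>i. \<not> i \<le> m \<Longrightarrow> \<theta> i = undefined"
  shows "\<theta> \<in> Delta m n"
  using assms by (auto simp: Delta_def PiE_def extensional_def mono_on_def)

lemma Delta_le: "\<theta> \<in> Delta m n \<Longrightarrow> i \<le> m \<Longrightarrow> \<theta> i \<le> n"
  by (auto simp: Delta_def PiE_def)

lemma Delta_mono: "\<theta> \<in> Delta m n \<Longrightarrow> i \<le> j \<Longrightarrow> j \<le> m \<Longrightarrow> \<theta> i \<le> \<theta> j"
  by (auto simp: Delta_def mono_on_def)

lemma Delta_undefined: "\<theta> \<in> Delta m n \<Longrightarrow> \<not> i \<le> m \<Longrightarrow> \<theta> i = undefined"
  by (auto simp: Delta_def PiE_def extensional_def)

lemma Delta_eqI:
  assumes "\<theta> \<in> Delta m n" "\<phi> \<in> Delta m n'" "\<And>i. i \<le> m \<Longrightarrow> \<theta> i = \<phi> i"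
  shows "\<theta> = \<phi>"
proof
  fix i show "\<theta> i = \<phi> i"
    by (cases "i \<le> m") (use assms Delta_undefined in \<open>metis\<close>)+
qed

lemma Delta_id [simp]: "(\<lambda>i\<in>{..n}. i) \<in> Delta n n"
  by (rule DeltaI) auto

lemma Delta_const_iff: "(\<lambda>i\<in>{..m}. c) \<in> Delta m n \<longleftrightarrow> c \<le> n"
  by (auto intro: DeltaI dest: Delta_le[of _ _ _ 0])

lemma Delta_compose: "\<phi> \<in> Delta l m \<Longrightarrow> \<theta> \<in> Delta m n \<Longrightarrow> compose {..l} \<theta> \<phi> \<in> Delta l n"
  by (rule DeltaI) (auto simp: compose_def Delta_le Delta_mono)

lemma compose_Delta_id: "\<theta> \<in> Delta m n \<Longrightarrow> compose {..m} \<theta> (\<lambda>i\<in>{..m}. i) = \<theta>"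
  by (rule Delta_eqI[OF Delta_compose[OF Delta_id]]) (auto simp: compose_def)

lemma compose_id_Delta: "\<theta> \<in> Delta m n \<Longrightarrow> compose {..m} (\<lambda>i\<in>{..n}. i) \<theta> = \<theta>"
  by (rule Delta_eqI[OF Delta_compose[OF _ Delta_id]]) (auto simp: compose_def Delta_le)

lemma compose_Delta_assoc:
  "\<phi> \<in> Delta k l \<Longrightarrow> \<psi> \<in> Delta l m \<Longrightarrow>
    compose {..k} (compose {..l} \<theta> \<psi>) \<phi> = compose {..k} \<theta> (compose {..k} \<psi> \<phi>)"
  by (auto simp: compose_def fun_eq_iff Delta_le)

lemma compose_const:
  "\<phi> \<in> Delta l m \<Longrightarrow> compose {..l} (\<lambda>i\<in>{..m}. c) \<phi> = (\<lambda>i\<in>{..l}. c)"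
  by (auto simp: compose_def fun_eq_iff Delta_le)

text \<open>Any set-theoretic section of a monotone map between linear orders is monotone, so a
  section can be made to pass through a prescribed point \<open>i\<close>. This freedom later
  separates two epimorphisms.\<close>

lemma Delta_section:
  assumes \<theta>: "\<theta> \<in> Delta l m" and surj: "{..m} \<subseteq> \<theta> ` {..l}" and i: "i \<le> l"
  obtains \<sigma> where "\<sigma> \<in> Delta m l" "compose {..m} \<theta> \<sigma> = (\<lambda>j\<in>{..m}. j)" "\<sigma> (\<theta> i) = i"
proof -
  have "\<forall>j\<in>{..m}. \<exists>x. x \<le> l \<and> \<theta> x = j"
    using surj by (auto simp: image_def)
  then obtain s where s: "\<And>j. j \<le> m \<Longrightarrow> s j \<le> l \<and> \<theta> (s j) = j"
    by (metis atMost_iff)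
  define \<sigma> where "\<sigma> = (\<lambda>j\<in>{..m}. if j = \<theta> i then i else s j)"
  have r: "\<theta> (\<sigma> j) = j" "\<sigma> j \<le> l" if "j \<le> m" for j
    using s[OF that] i that by (auto simp: \<sigma>_def)
  have "\<sigma> \<in> Delta m l"
  proof (rule DeltaI)
    fix j j' :: nat assume j: "j \<le> j'" "j' \<le> m"
    show "\<sigma> j \<le> \<sigma> j'"
      using Delta_mono[OF \<theta>, of "\<sigma> j'" "\<sigma> j"] r[of j] r[of j'] j
      by (metis le_antisym le_trans nle_le)
  qed (use r in \<open>auto simp: \<sigma>_def\<close>)
  moreover have "compose {..m} \<theta> \<sigma> = (\<lambda>j\<in>{..m}. j)"
    using r by (auto simp: compose_def)
  moreover have "\<sigma> (\<theta> i) = i"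
    using Delta_le[OF \<theta> i] by (simp add: \<sigma>_def)
  ultimately show thesis by (rule that)
qed

text \<open>A surjective endomap of a finite set is injective, so a monotone one is strictly
  increasing; climbing from 0 gives \<open>i \<le> \<theta> i\<close>, descending from
  \<open>m\<close> gives the converse.\<close>

lemma Delta_endo_surj_id:
  assumes "\<theta> \<in> Delta m m" "{..m} \<subseteq> \<theta> ` {..m}"
  shows "\<theta> = (\<lambda>i\<in>{..m}. i)"
proof -
  have img: "\<theta> ` {..m} = {..m}"
    using assms Delta_le by blast
  then have inj: "inj_on \<theta> {..m}"
    by (simp add: eq_card_imp_inj_on)
  have less: "\<theta> i < \<theta> j" if "i < j" "j \<le> m" for i j
    using Delta_mono[OF assms(1), of i j] that inj
    by (metis atMost_iff inj_onD le_neq_implies_less less_imp_le less_irrefl order_trans)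
  have ge: "i \<le> \<theta> i" if "i \<le> m" for i
    using that
  proof (induction i)
    case (Suc i)
    then show ?case using less[of i "Suc i"] by simp
  qed simp
  have "\<theta> (m - d) \<le> m - d" if "d \<le> m" for d
    using that
  proof (induction d)
    case 0
    then show ?case using Delta_le[OF assms(1)] by simp
  next
    case (Suc d)
    then show ?case using less[of "m - Suc d" "m - d"] by (simp add: diff_less_mono2)
  qed
  then have "\<theta> i \<le> i" if "i \<le> m" for i
    using that by (metis diff_diff_cancel diff_le_self)
  with ge have "\<theta> i = i" if "i \<le> m" for i
    using that by (simp add: le_antisym)
  then show ?thesis
    by (intro Delta_eqI[OF assms(1) Delta_id]) auto
qed

section \<open>Face maps\<close>

definition face :: "nat \<Rightarrow> nat \<Rightarrow> nat \<Rightarrow> nat" where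
  "face m j = (\<lambda>i\<in>{..m}. if i < j then i else Suc i)"

lemma face_Delta: "face m j \<in> Delta m (Suc m)"
  by (rule DeltaI) (auto simp: face_def)

lemma face_omits: "j \<notin> face m j ` {..m}"
  by (auto simp: face_def)

lemma Delta_factor_face:
  assumes \<theta>: "\<theta> \<in> Delta l n" and j: "j \<le> n" "j \<notin> \<theta> ` {..l}"
  obtains m \<phi> where "n = Suc m" "\<phi> \<in> Delta l m" "\<theta> = compose {..l} (face m j) \<phi>"
proof -
  have ne: "\<theta> i \<noteq> j" if "i \<le> l" for i using j that by auto
  have "n \<noteq> 0" using ne[of 0] Delta_le[OF \<theta>, of 0] j by auto
  then obtain m where n: "n = Suc m" by (cases n) auto
  define \<phi> where "\<phi> = (\<lambda>i\<in>{..l}. if \<theta> i < j then \<theta> i else \<theta> i - 1)"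
  have \<phi>: "\<phi> \<in> Delta l m"
  proof (rule DeltaI)
    fix i assume "i \<le> l"
    then show "\<phi> i \<le> m"
      using Delta_le[OF \<theta>, of i] ne[of i] j n by (auto simp: \<phi>_def)
  next
    fix i i' assume "i \<le> i'" "i' \<le> l"
    then show "\<phi> i \<le> \<phi> i'"
      using Delta_mono[OF \<theta>, of i i'] ne[of i] ne[of i'] by (auto simp: \<phi>_def)
  qed (auto simp: \<phi>_def)
  have "\<theta> = compose {..l} (face m j) \<phi>"
  proof (rule Delta_eqI[OF \<theta> Delta_compose[OF \<phi> face_Delta]])
    fix i assume i: "i \<le> l"
    then show "\<theta> i = compose {..l} (face m j) \<phi> i"
      using ne[of i] Delta_le[OF \<phi> i] by (auto simp: compose_def face_def \<phi>_def)
  qed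
  with n \<phi> show thesis by (rule that)
qed


section \<open>Simplicial sets and lifting\<close>

lemma simplicial_setI:
  assumes "\<And>m n \<theta> x. \<theta> \<in> Delta m n \<Longrightarrow> x \<in> cells X n \<Longrightarrow> restr X m n \<theta> x \<in> cells X m"
    and "\<And>n x. x \<in> cells X n \<Longrightarrow> restr X n n (\<lambda>i\<in>{..n}. i) x = x"
    and "\<And>l m n \<phi> \<theta> x. \<phi> \<in> Delta l m \<Longrightarrow> \<theta> \<in> Delta m n \<Longrightarrow> x \<in> cells X n \<Longrightarrow>
      restr X l n (compose {..l} \<theta> \<phi>) x = restr X l m \<phi> (restr X m n \<theta> x)"
  shows "simplicial_set X"
  using assms unfolding simplicial_set_def by blast

lemma restr_cell:
  "simplicial_set X \<Longrightarrow> \<theta> \<in> Delta m n \<Longrightarrow> x \<in> cells X n \<Longrightarrow> restr X m n \<theta> x \<in> cells X m"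
  unfolding simplicial_set_def by blast

lemma restr_id:
  "simplicial_set X \<Longrightarrow> x \<in> cells X n \<Longrightarrow> restr X n n (\<lambda>i\<in>{..n}. i) x = x"
  unfolding simplicial_set_def by blast

lemma restr_compose:
  "simplicial_set X \<Longrightarrow> \<phi> \<in> Delta l m \<Longrightarrow> \<theta> \<in> Delta m n \<Longrightarrow> x \<in> cells X n \<Longrightarrow>
    restr X l n (compose {..l} \<theta> \<phi>) x = restr X l m \<phi> (restr X m n \<theta> x)"
  unfolding simplicial_set_def by blast

lemma simplicial_mapI:
  assumes "simplicial_set X" "simplicial_set Y"
    and "\<And>n x. x \<in> cells X n \<Longrightarrow> h n x \<in> cells Y n"
    and "\<And>m n \<theta> x. \<theta> \<in> Delta m n \<Longrightarrow> x \<in> cells X n \<Longrightarrow>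
      h m (restr X m n \<theta> x) = restr Y m n \<theta> (h n x)"
  shows "simplicial_map X Y h"
  using assms unfolding simplicial_map_def by blast

lemma map_dom: "simplicial_map X Y h \<Longrightarrow> simplicial_set X"
  and map_cod: "simplicial_map X Y h \<Longrightarrow> simplicial_set Y"
  and map_cell: "simplicial_map X Y h \<Longrightarrow> x \<in> cells X n \<Longrightarrow> h n x \<in> cells Y n"
  and map_restr: "simplicial_map X Y h \<Longrightarrow> \<theta> \<in> Delta m n \<Longrightarrow> x \<in> cells X n \<Longrightarrow>
    h m (restr X m n \<theta> x) = restr Y m n \<theta> (h n x)"
  unfolding simplicial_map_def by blast+

lemma simplicial_map_comp:
  assumes "simplicial_map X Y h" "simplicial_map Y Z g"
  shows "simplicial_map X Z (\<lambda>n x. g n (h n x))"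
  using assms by (auto simp: simplicial_map_def)

section \<open>Subcomplexes and relative lifting\<close>

definition subcomplex :: "'a sset \<Rightarrow> (nat \<Rightarrow> 'a set) \<Rightarrow> bool" where
  "subcomplex K M \<longleftrightarrow> (\<forall>n. M n \<subseteq> cells K n) \<and>
     (\<forall>m n. \<forall>\<theta> \<in> Delta m n. \<forall>x \<in> M n. restr K m n \<theta> x \<in> M m)"

lemma subcomplexI:
  assumes "\<And>n x. x \<in> M n \<Longrightarrow> x \<in> cells K n"
    and "\<And>m n \<theta> x. \<theta> \<in> Delta m n \<Longrightarrow> x \<in> M n \<Longrightarrow> restr K m n \<theta> x \<in> M m"
  shows "subcomplex K M"
  using assms by (auto simp: subcomplex_def)

lemma subcomplex_cell: "subcomplex K M \<Longrightarrow> x \<in> M n \<Longrightarrow> x \<in> cells K n"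
  and subcomplex_restr: "subcomplex K M \<Longrightarrow> \<theta> \<in> Delta m n \<Longrightarrow> x \<in> M n \<Longrightarrow> restr K m n \<theta> x \<in> M m"
  by (auto simp: subcomplex_def)

lemma simplicial_set_sub:
  "simplicial_set K \<Longrightarrow> subcomplex K M \<Longrightarrow> simplicial_set (K\<lparr>cells := M\<rparr>)"
  unfolding simplicial_set_def subcomplex_def by (auto; blast)

lemma simplicial_map_sub:
  assumes "simplicial_map K X u" "subcomplex K M"
  shows "simplicial_map (K\<lparr>cells := M\<rparr>) X u"
  using assms simplicial_set_sub[of K M] unfolding simplicial_map_def subcomplex_def
  by (auto; blast)

text \<open>The inclusion is given by a family \<open>M\<close> of cell sets rather than by a map,
  so that extending \<open>u\<close> means equality on cells and nested inclusions compose without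
  transport.\<close>

definition llp ::
  "'k sset \<Rightarrow> (nat \<Rightarrow> 'k set) \<Rightarrow> 'x sset \<Rightarrow> 'y sset \<Rightarrow> (nat \<Rightarrow> 'x \<Rightarrow> 'y) \<Rightarrow> bool" where
  "llp K M X Y p \<longleftrightarrow>
     (\<forall>u v. simplicial_map (K\<lparr>cells := M\<rparr>) X u \<longrightarrow> simplicial_map K Y v \<longrightarrow>
        (\<forall>m. \<forall>x \<in> M m. p m (u m x) = v m x) \<longrightarrow>
        (\<exists>w. simplicial_map K X w \<and> (\<forall>m. \<forall>x \<in> M m. w m x = u m x) \<and>
             (\<forall>m. \<forall>x \<in> cells K m. p m (w m x) = v m x)))"

lemma llpE:
  assumes "llp K M X Y p" "simplicial_map (K\<lparr>cells := M\<rparr>) X u" "simplicial_map K Y v"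
    and "\<And>m x. x \<in> M m \<Longrightarrow> p m (u m x) = v m x"
  obtains w where "simplicial_map K X w" "\<And>m x. x \<in> M m \<Longrightarrow> w m x = u m x"
    "\<And>m x. x \<in> cells K m \<Longrightarrow> p m (w m x) = v m x"
  using assms unfolding llp_def by metis

lemma llpI:
  assumes "\<And>u v. simplicial_map (K\<lparr>cells := M\<rparr>) X u \<Longrightarrow> simplicial_map K Y v \<Longrightarrow>
      (\<And>m x. x \<in> M m \<Longrightarrow> p m (u m x) = v m x) \<Longrightarrow>
      \<exists>w. simplicial_map K X w \<and> (\<forall>m. \<forall>x \<in> M m. w m x = u m x) \<and>
             (\<forall>m. \<forall>x \<in> cells K m. p m (w m x) = v m x)"
  shows "llp K M X Y p"
  using assms unfolding llp_def by blast

lemma horn_sub: "horn n k = (simplex n)\<lparr>cells := cells (horn n k)\<rparr>"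
  by (simp add: horn_def)

lemma kan_fibration_llp:
  "kan_fibration X Y p \<longleftrightarrow> simplicial_map X Y p \<and>
    (\<forall>n k. 1 \<le> n \<longrightarrow> k \<le> n \<longrightarrow> llp (simplex n) (cells (horn n k)) X Y p)"
  unfolding kan_fibration_def llp_def horn_sub[symmetric] by blast

text \<open>\<open>K\<close> is the pushout of \<open>M\<close> and \<open>J\<close> along the
  preimage of \<open>M\<close>, because \<open>s\<close> is injective outside \<open>M\<close> and
  covers the complement; a lift on \<open>J\<close> is glued to \<open>u\<close>. Inside
  \<open>M\<close> the map \<open>s\<close> may identify cells.\<close>

lemma llp_pushout:
  assumes M: "subcomplex K M" and s: "simplicial_map J K s"
    and inj: "\<And>n y y'. y \<in> cells J n \<Longrightarrow> y' \<in> cells J n \<Longrightarrow> s n y = s n y' \<Longrightarrow>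
      s n y \<notin> M n \<Longrightarrow> y = y'"
    and cover: "\<And>n x. x \<in> cells K n \<Longrightarrow> x \<notin> M n \<Longrightarrow> x \<in> s n ` cells J n"
    and llp: "llp J (\<lambda>n. {y \<in> cells J n. s n y \<in> M n}) X Y p"
  shows "llp K M X Y p"
proof (rule llpI)
  fix u v
  assume u: "simplicial_map (K\<lparr>cells := M\<rparr>) X u" and v: "simplicial_map K Y v"
    and uv: "\<And>m x. x \<in> M m \<Longrightarrow> p m (u m x) = v m x"
  let ?D = "\<lambda>n. {y \<in> cells J n. s n y \<in> M n}"
  note J = map_dom[OF s] and K = map_cod[OF s]
  have D: "subcomplex J ?D"
    by (rule subcomplexI) (auto simp: restr_cell[OF J] map_restr[OF s] subcomplex_restr[OF M])
  have us: "simplicial_map (J\<lparr>cells := ?D\<rparr>) X (\<lambda>n y. u n (s n y))"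
  proof (rule simplicial_mapI)
    show "simplicial_set (J\<lparr>cells := ?D\<rparr>)" by (rule simplicial_set_sub[OF J D])
  qed (use map_cell[OF u] map_restr[OF u] map_restr[OF s] map_cod[OF u] in auto)
  obtain w' where w': "simplicial_map J X w'" "\<And>m x. x \<in> ?D m \<Longrightarrow> w' m x = u m (s m x)"
    "\<And>m x. x \<in> cells J m \<Longrightarrow> p m (w' m x) = v m (s m x)"
    by (rule llpE[OF llp us simplicial_map_comp[OF s v]]) (use uv in auto)
  \<comment> \<open>Outside \<open>M\<close> the preimage is unique, so the choice is forced; inside
    \<open>M\<close> the value must come from \<open>u\<close>, since a preimage may fail to exist
    or to be unique.\<close>
  define w where
    "w n x = (if x \<in> M n then u n x else w' n (SOME y. y \<in> cells J n \<and> s n y = x))" for n x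
  have ws: "w n (s n y) = w' n y" if y: "y \<in> cells J n" for n y
  proof (cases "s n y \<in> M n")
    case True
    then show ?thesis using w'(2) y by (simp add: w_def)
  next
    case False
    have "(SOME z. z \<in> cells J n \<and> s n z = s n y) = y"
      by (rule some_equality) (use inj y False in auto)
    then show ?thesis using False by (simp add: w_def)
  qed
  have wu: "w n x = u n x" if "x \<in> M n" for n x
    using that by (simp add: w_def)
  have "simplicial_map K X w"
  proof (rule simplicial_mapI[OF K map_cod[OF u]])
    fix n x assume "x \<in> cells K n"
    then show "w n x \<in> cells X n"
      using cover[of x n] wu map_cell[OF u] ws map_cell[OF w'(1)] by (cases "x \<in> M n") auto
  next
    fix m n \<theta> x assume \<theta>: "\<theta> \<in> Delta m n" and x: "x \<in> cells K n"
    show "w m (restr K m n \<theta> x) = restr X m n \<theta> (w n x)"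
    proof (cases "x \<in> M n")
      case True
      then show ?thesis
        using wu subcomplex_restr[OF M \<theta>] map_restr[OF u \<theta>] by simp
    next
      case False
      then obtain y where "y \<in> cells J n" "x = s n y" using cover x by blast
      then show ?thesis
        using ws map_restr[OF s \<theta>] map_restr[OF w'(1) \<theta>] restr_cell[OF J \<theta>] by metis
    qed
  qed
  moreover have "p n (w n x) = v n x" if "x \<in> cells K n" for n x
    using cover[OF that] wu uv ws w'(3) by (cases "x \<in> M n") auto
  ultimately show "\<exists>w. simplicial_map K X w \<and> (\<forall>m. \<forall>x \<in> M m. w m x = u m x) \<and>
      (\<forall>m. \<forall>x \<in> cells K m. p m (w m x) = v m x)"
    using wu by blast
qed

lemma llp_trans:
  assumes N: "subcomplex K N" and MN: "\<And>n. M n \<subseteq> N n"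
    and 1: "llp (K\<lparr>cells := N\<rparr>) M X Y p" and 2: "llp K N X Y p"
  shows "llp K M X Y p"
proof (rule llpI)
  fix u v
  assume u: "simplicial_map (K\<lparr>cells := M\<rparr>) X u" and v: "simplicial_map K Y v"
    and uv: "\<And>m x. x \<in> M m \<Longrightarrow> p m (u m x) = v m x"
  obtain w1 where w1: "simplicial_map (K\<lparr>cells := N\<rparr>) X w1" "\<And>m x. x \<in> M m \<Longrightarrow> w1 m x = u m x"
    "\<And>m x. x \<in> N m \<Longrightarrow> p m (w1 m x) = v m x"
    using llpE[OF 1 _ simplicial_map_sub[OF v N], of u] u uv by auto
  obtain w where "simplicial_map K X w" "\<And>m x. x \<in> N m \<Longrightarrow> w m x = w1 m x"
    "\<And>m x. x \<in> cells K m \<Longrightarrow> p m (w m x) = v m x"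
    using llpE[OF 2 w1(1) v] w1(3) by blast
  then show "\<exists>w. simplicial_map K X w \<and> (\<forall>m. \<forall>x \<in> M m. w m x = u m x) \<and>
      (\<forall>m. \<forall>x \<in> cells K m. p m (w m x) = v m x)"
    using w1(2) MN by (metis subsetD)
qed

lemma llp_refl: "llp K (cells K) X Y p"
proof (rule llpI)
  fix u v
  assume u: "simplicial_map (K\<lparr>cells := cells K\<rparr>) X u"
    and "\<And>m x. x \<in> cells K m \<Longrightarrow> p m (u m x) = v m x"
  then show "\<exists>w. simplicial_map K X w \<and> (\<forall>m. \<forall>x \<in> cells K m. w m x = u m x) \<and>
      (\<forall>m. \<forall>x \<in> cells K m. p m (w m x) = v m x)"
    by (intro exI[of _ u]) auto
qed

text \<open>Transfinite composition of the inclusions in \<open>step\<close>, by Zorn's lemma on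
  partial lifts. The invariant \<open>C\<close> restricts the domains considered, so that
  \<open>step\<close> has to extend only from subcomplexes of a special shape.\<close>

lemma llp_Zorn:
  fixes K :: "'k sset" and X :: "'x sset" and Y :: "'y sset"
  assumes K: "simplicial_set K" and L: "subcomplex K L" "C L"
    and union: "\<And>F. F \<noteq> {} \<Longrightarrow> (\<And>M. M \<in> F \<Longrightarrow> C M) \<Longrightarrow> C (\<lambda>n. \<Union>M\<in>F. M n)"
    and step: "\<And>M. subcomplex K M \<Longrightarrow> C M \<Longrightarrow> (\<And>n. L n \<subseteq> M n) \<Longrightarrow> M \<noteq> cells K \<Longrightarrow>
      \<exists>N. subcomplex K N \<and> C N \<and> (\<forall>n. M n \<subseteq> N n) \<and> M \<noteq> N \<and> llp (K\<lparr>cells := N\<rparr>) M X Y p"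
  shows "llp K L X Y p"
proof (rule llpI)
  fix u v
  assume u: "simplicial_map (K\<lparr>cells := L\<rparr>) X u" and v: "simplicial_map K Y v"
    and uv: "\<And>m x. x \<in> L m \<Longrightarrow> p m (u m x) = v m x"
  \<comment> \<open>Partial lifts are encoded by their graphs, so that extending a lift is set
    inclusion and the union of a chain is again a candidate.\<close>
  define dm where "dm G n = {x. \<exists>y. (n, x, y) \<in> G}" for G :: "(nat \<times> 'k \<times> 'x) set" and n
  define lift where "lift G \<longleftrightarrow>
     (\<forall>n x y. (n, x, y) \<in> G \<longrightarrow> x \<in> cells K n \<and> y \<in> cells X n \<and> p n y = v n x) \<and>
     (\<forall>n x y y'. (n, x, y) \<in> G \<longrightarrow> (n, x, y') \<in> G \<longrightarrow> y = y') \<and>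
     (\<forall>m n \<theta> x y. \<theta> \<in> Delta m n \<longrightarrow> (n, x, y) \<in> G \<longrightarrow>
        (m, restr K m n \<theta> x, restr X m n \<theta> y) \<in> G) \<and>
     C (dm G) \<and> (\<forall>n. \<forall>x\<in>L n. (n, x, u n x) \<in> G)" for G
  define graph where "graph M w = {(n, x, w n x) |n x. x \<in> M n}"
    for M :: "nat \<Rightarrow> 'k set" and w :: "nat \<Rightarrow> 'k \<Rightarrow> 'x"
  have dm_graph: "dm (graph M w) = M" for M w
    by (auto simp: dm_def graph_def)
  have lift_graph: "lift (graph M w)"
    if M: "subcomplex K M" "C M" and w: "simplicial_map (K\<lparr>cells := M\<rparr>) X w"
      and wv: "\<And>n x. x \<in> M n \<Longrightarrow> p n (w n x) = v n x"
      and LM: "\<And>n x. x \<in> L n \<Longrightarrow> x \<in> M n \<and> w n x = u n x" for M w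
    unfolding lift_def dm_graph
  proof (intro conjI allI impI ballI)
    fix n x y assume "(n, x, y) \<in> graph M w"
    then have x: "x \<in> M n" "y = w n x" by (simp_all add: graph_def)
    show "x \<in> cells K n" by (rule subcomplex_cell[OF M(1) x(1)])
    show "y \<in> cells X n" using map_cell[OF w, of x n] x by simp
    show "p n y = v n x" using wv x by simp
    show "y = y'" if "(n, x, y') \<in> graph M w" for y'
      using x that by (simp add: graph_def)
    show "(m, restr K m n \<theta> x, restr X m n \<theta> y) \<in> graph M w" if "\<theta> \<in> Delta m n" for m \<theta>
      using x map_restr[OF w that, of x] subcomplex_restr[OF M(1) that, of x]
      by (simp add: graph_def)
  qed (use M(2) LM in \<open>simp_all add: graph_def\<close>)
  have "\<exists>G\<in>Collect lift. \<forall>H\<in>Collect lift. G \<subseteq> H \<longrightarrow> H = G"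
  proof (rule subset_Zorn_nonempty)
    show "Collect lift \<noteq> {}"
      using lift_graph[OF L u uv] by auto
  next
    fix F assume F: "F \<noteq> {}" "subset.chain (Collect lift) F"
    have lift: "lift G" if "G \<in> F" for G
      using F(2) that by (auto simp: subset.chain_def)
    have two: "\<exists>G\<in>F. a \<in> G \<and> b \<in> G" if "a \<in> \<Union>F" "b \<in> \<Union>F" for a b
    proof -
      obtain G H where "a \<in> G" "G \<in> F" "b \<in> H" "H \<in> F" using \<open>a \<in> \<Union>F\<close> \<open>b \<in> \<Union>F\<close> by blast
      moreover from this have "G \<subseteq> H \<or> H \<subseteq> G"
        using F(2) by (auto simp: subset_chain_def)
      ultimately show ?thesis by blast
    qed
    have "dm (\<Union>F) = (\<lambda>n. \<Union>M\<in>dm ` F. M n)"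
      by (auto simp: dm_def fun_eq_iff)
    moreover have "C (\<lambda>n. \<Union>M\<in>dm ` F. M n)"
    proof (rule union)
      show "C M" if "M \<in> dm ` F" for M
        using that lift unfolding lift_def by blast
    qed (use F(1) in simp)
    ultimately have 1: "C (dm (\<Union>F))" by simp
    have 2: "y = y'" if "(n, x, y) \<in> \<Union>F" "(n, x, y') \<in> \<Union>F" for n x y y'
      using two[OF that] lift unfolding lift_def by blast
    have 3: "(n, x, u n x) \<in> \<Union>F" if "x \<in> L n" for n x
      using F(1) lift that unfolding lift_def by blast
    have 4: "x \<in> cells K n \<and> y \<in> cells X n \<and> p n y = v n x" if "(n, x, y) \<in> \<Union>F" for n x y
      using lift that unfolding lift_def by blast
    have 5: "(m, restr K m n \<theta> x, restr X m n \<theta> y) \<in> \<Union>F"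
      if "\<theta> \<in> Delta m n" "(n, x, y) \<in> \<Union>F" for m n \<theta> x y
      using lift that unfolding lift_def by blast
    have "lift (\<Union>F)"
      unfolding lift_def
      by (intro conjI allI impI ballI; (fact 1 | erule (1) 2 | erule 3 | erule (1) 5 | drule 4, simp))
    then show "\<Union>F \<in> Collect lift" by simp
  qed
  then obtain G where G: "lift G" and max: "\<And>H. lift H \<Longrightarrow> G \<subseteq> H \<Longrightarrow> H = G" by blast
  note G' = G[unfolded lift_def]
  have Gc: "x \<in> cells K n" "y \<in> cells X n" "p n y = v n x" if "(n, x, y) \<in> G" for n x y
    using G'[THEN conjunct1] that by blast+
  have Gu: "y = y'" if "(n, x, y) \<in> G" "(n, x, y') \<in> G" for n x y y'
    using G'[THEN conjunct2, THEN conjunct1] that by blast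
  have Gr: "(m, restr K m n \<theta> x, restr X m n \<theta> y) \<in> G"
    if "\<theta> \<in> Delta m n" "(n, x, y) \<in> G" for m n \<theta> x y
    using G'[THEN conjunct2, THEN conjunct2, THEN conjunct1] that by blast
  have GC: "C (dm G)" and GL: "\<And>n x. x \<in> L n \<Longrightarrow> (n, x, u n x) \<in> G"
    using G'[THEN conjunct2, THEN conjunct2, THEN conjunct2] by blast+
  define w where "w n x = (THE y. (n, x, y) \<in> G)" for n x
  have w: "w n x = y" if "(n, x, y) \<in> G" for n x y
    unfolding w_def using that Gu by blast
  have dmE: "(n, x, w n x) \<in> G" if "x \<in> dm G n" for n x
    using that w unfolding dm_def by auto
  have dmI: "x \<in> dm G n" if "(n, x, y) \<in> G" for n x y
    using that unfolding dm_def by blast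
  have Gg: "G = graph (dm G) w"
    using w by (auto simp: graph_def dm_def)
  have sub: "subcomplex K (dm G)"
    by (rule subcomplexI) (use Gc Gr dmI dmE in blast)+
  have wm: "simplicial_map (K\<lparr>cells := dm G\<rparr>) X w"
  proof (rule simplicial_mapI[OF simplicial_set_sub[OF K sub] map_cod[OF u]])
    fix m n \<theta> x assume \<theta>: "\<theta> \<in> Delta m n" and "x \<in> cells (K\<lparr>cells := dm G\<rparr>) n"
    then show "w m (restr (K\<lparr>cells := dm G\<rparr>) m n \<theta> x) = restr X m n \<theta> (w n x)"
      using w[OF Gr[OF \<theta> dmE]] by simp
  next
    fix n x assume "x \<in> cells (K\<lparr>cells := dm G\<rparr>) n"
    then show "w n x \<in> cells X n"
      using Gc(2)[OF dmE, of x n] by simp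
  qed
  have "dm G = cells K"
  proof (rule ccontr)
    assume "dm G \<noteq> cells K"
    then obtain N where N: "subcomplex K N" "C N" "\<And>n. dm G n \<subseteq> N n" "dm G \<noteq> N"
      and llp: "llp (K\<lparr>cells := N\<rparr>) (dm G) X Y p"
      using step[OF sub GC] GL[THEN dmI] by blast
    obtain w' where w': "simplicial_map (K\<lparr>cells := N\<rparr>) X w'"
      "\<And>m x. x \<in> dm G m \<Longrightarrow> w' m x = w m x" "\<And>m x. x \<in> N m \<Longrightarrow> p m (w' m x) = v m x"
    proof (rule llpE[OF llp _ simplicial_map_sub[OF v N(1)]])
      show "simplicial_map ((K\<lparr>cells := N\<rparr>)\<lparr>cells := dm G\<rparr>) X w" using wm by simp
      show "p n (w n x) = v n x" if "x \<in> dm G n" for n x using Gc(3)[OF dmE[OF that]] .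
    qed auto
    have "lift (graph N w')"
    proof (rule lift_graph[OF N(1,2) w'(1,3)])
      fix n x assume "x \<in> L n"
      then show "x \<in> N n \<and> w' n x = u n x"
        using dmI[OF GL, of x n] N(3)[of n] w'(2)[of x n] w[OF GL, of x n] by auto
    qed
    moreover have "G \<subseteq> graph N w'"
      using subsetD[OF N(3)] w'(2) by (subst Gg) (auto simp: graph_def)
    ultimately have "graph N w' = G" by (rule max)
    then show False using N(4) dm_graph[of N w'] by simp
  qed
  then have "simplicial_map K X w" using wm by simp
  then show "\<exists>w. simplicial_map K X w \<and> (\<forall>m. \<forall>x \<in> L m. w m x = u m x) \<and>
      (\<forall>m. \<forall>x \<in> cells K m. p m (w m x) = v m x)"
    using \<open>dm G = cells K\<close> w[OF GL] Gc(3)[OF dmE] by (intro exI[of _ w]) auto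
qed


text \<open>The base simplex is lifted along \<open>q\<close> first, and the result along
  \<open>p\<close>. With \<open>Z\<close> the point, this turns total spaces over a Kan complex into
  Kan complexes.\<close>

lemma kan_fibration_comp:
  assumes p: "kan_fibration X Y p" and q: "kan_fibration Y Z q"
  shows "kan_fibration X Z (\<lambda>n x. q n (p n x))"
  unfolding kan_fibration_llp
proof (intro conjI allI impI)
  have pm: "simplicial_map X Y p" and qm: "simplicial_map Y Z q"
    using p q by (auto simp: kan_fibration_def)
  then show "simplicial_map X Z (\<lambda>n x. q n (p n x))" by (rule simplicial_map_comp)
  fix n k :: nat assume nk: "1 \<le> n" "k \<le> n"
  show "llp (simplex n) (cells (horn n k)) X Z (\<lambda>n x. q n (p n x))"
  proof (rule llpI)
    fix u v
    assume u: "simplicial_map (simplex n\<lparr>cells := cells (horn n k)\<rparr>) X u"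
      and v: "simplicial_map (simplex n) Z v"
      and uv: "\<And>m \<theta>. \<theta> \<in> cells (horn n k) m \<Longrightarrow> q m (p m (u m \<theta>)) = v m \<theta>"
    have lp: "llp (simplex n) (cells (horn n k)) X Y p" and lq: "llp (simplex n) (cells (horn n k)) Y Z q"
      using p q nk by (auto simp: kan_fibration_llp)
    obtain y where y: "simplicial_map (simplex n) Y y"
      "\<And>m \<theta>. \<theta> \<in> cells (horn n k) m \<Longrightarrow> y m \<theta> = p m (u m \<theta>)"
      "\<And>m \<theta>. \<theta> \<in> cells (simplex n) m \<Longrightarrow> q m (y m \<theta>) = v m \<theta>"
      by (rule llpE[OF lq simplicial_map_comp[OF u pm] v]) (use uv in auto)
    obtain w where "simplicial_map (simplex n) X w"
      "\<And>m \<theta>. \<theta> \<in> cells (horn n k) m \<Longrightarrow> w m \<theta> = u m \<theta>"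
      "\<And>m \<theta>. \<theta> \<in> cells (simplex n) m \<Longrightarrow> p m (w m \<theta>) = y m \<theta>"
      by (rule llpE[OF lp u y(1)]) (use y(2) in auto)
    with y(3) show "\<exists>w. simplicial_map (simplex n) X w \<and>
        (\<forall>m. \<forall>\<theta>\<in>cells (horn n k) m. w m \<theta> = u m \<theta>) \<and>
        (\<forall>m. \<forall>\<theta>\<in>cells (simplex n) m. q m (p m (w m \<theta>)) = v m \<theta>)"
      by (intro exI[of _ w]) simp
  qed
qed

lemma terminal_map: "simplicial_set X \<Longrightarrow> simplicial_map X terminal_sset (\<lambda>_ _. ())"
  by (rule simplicial_mapI) (auto simp: terminal_sset_def simplicial_set_def)

lemma subcomplex_Un:
  "subcomplex K M \<Longrightarrow> subcomplex K N \<Longrightarrow> subcomplex K (\<lambda>n. M n \<union> N n)"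
  by (auto simp: subcomplex_def)

lemma subcomplex_UN:
  "(\<And>i. i \<in> I \<Longrightarrow> subcomplex K (M i)) \<Longrightarrow> subcomplex K (\<lambda>n. \<Union>i\<in>I. M i n)"
  by (rule subcomplexI) (auto dest: subcomplex_cell subcomplex_restr)


section \<open>Cylinders\<close>

definition cylinder :: "'k sset \<Rightarrow> ('k \<times> (nat \<Rightarrow> nat)) sset" where
  "cylinder K = \<lparr>cells = (\<lambda>n. cells K n \<times> Delta n 1),
                 restr = (\<lambda>m n \<theta> (x, \<epsilon>). (restr K m n \<theta> x, compose {..m} \<epsilon> \<theta>))\<rparr>"

text \<open>The part \<open>K \<times> {e} \<union> L \<times> \<Delta>\<^sup>1\<close> of the cylinder on \<open>K\<close>.\<close>

definition open_box :: "nat \<Rightarrow> 'k sset \<Rightarrow> (nat \<Rightarrow> 'k set) \<Rightarrow> nat \<Rightarrow> ('k \<times> (nat \<Rightarrow> nat)) set" where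
  "open_box e K L n =
     {(x, \<epsilon>). x \<in> cells K n \<and> \<epsilon> \<in> Delta n 1 \<and> (x \<in> L n \<or> \<epsilon> = (\<lambda>i\<in>{..n}. e))}"

lemma cells_cylinder [simp]: "cells (cylinder K) n = cells K n \<times> Delta n 1"
  by (simp add: cylinder_def)

lemma restr_cylinder [simp]:
  "restr (cylinder K) m n \<theta> (x, \<epsilon>) = (restr K m n \<theta> x, compose {..m} \<epsilon> \<theta>)"
  by (simp add: cylinder_def)

lemma simplicial_set_cylinder: "simplicial_set K \<Longrightarrow> simplicial_set (cylinder K)"
  by (rule simplicial_setI)
    (auto simp: restr_cell Delta_compose restr_id compose_Delta_id restr_compose
      compose_Delta_assoc)

lemma subcomplex_open_box:
  "simplicial_set K \<Longrightarrow> subcomplex K L \<Longrightarrow> subcomplex (cylinder K) (open_box e K L)"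
  by (rule subcomplexI)
    (auto simp: open_box_def restr_cell Delta_compose subcomplex_restr compose_const Delta_const_iff)

section \<open>Standard simplices, boundaries and prisms\<close>

lemma cells_simplex [simp]: "cells (simplex n) m = Delta m n"
  by (simp add: simplex_def)

lemma restr_simplex [simp]: "restr (simplex n) l m \<phi> \<theta> = compose {..l} \<theta> \<phi>"
  by (simp add: simplex_def)

lemma simplicial_set_simplex: "simplicial_set (simplex n)"
  by (rule simplicial_setI) (auto simp: Delta_compose compose_Delta_id compose_Delta_assoc)

lemma cells_horn:
  "cells (horn n k) m = {\<theta> \<in> Delta m n. \<exists>j \<le> n. j \<noteq> k \<and> j \<notin> \<theta> ` {..m}}"
  by (auto simp: horn_def)

definition boundary :: "nat \<Rightarrow> nat \<Rightarrow> (nat \<Rightarrow> nat) set" where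
  "boundary m l = {\<theta> \<in> Delta l m. \<exists>j \<le> m. j \<notin> \<theta> ` {..l}}"

lemma subcomplex_boundary: "subcomplex (simplex m) (boundary m)"
proof (rule subcomplexI)
  fix k l \<phi> \<theta> assume \<phi>: "\<phi> \<in> Delta k l" and "\<theta> \<in> boundary m l"
  moreover have "compose {..k} \<theta> \<phi> ` {..k} \<subseteq> \<theta> ` {..l}"
    using Delta_le[OF \<phi>] by (auto simp: compose_def)
  ultimately show "restr (simplex m) k l \<phi> \<theta> \<in> boundary m k"
    by (auto simp: boundary_def Delta_compose)
qed (simp add: boundary_def)

lemma subcomplex_horn: "subcomplex (simplex n) (cells (horn n k))"
proof (rule subcomplexI)
  fix l m \<phi> \<theta> assume \<phi>: "\<phi> \<in> Delta l m" and "\<theta> \<in> cells (horn n k) m"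
  moreover have "compose {..l} \<theta> \<phi> ` {..l} \<subseteq> \<theta> ` {..m}"
    using Delta_le[OF \<phi>] by (auto simp: compose_def)
  ultimately show "restr (simplex n) l m \<phi> \<theta> \<in> cells (horn n k) l"
    by (auto simp: cells_horn Delta_compose)
qed (simp add: cells_horn)

text \<open>The nondegenerate \<open>(m+1)\<close>-simplices of \<open>\<Delta>\<^sup>m \<times> \<Delta>\<^sup>1\<close>: the path \<open>shuffle m j\<close>
  in the grid \<open>[m] \<times> [1]\<close> changes level at \<open>j\<close>. The cells of the subcomplex
  generated by it are those in \<open>block m j\<close>.\<close>

definition shuffle :: "nat \<Rightarrow> nat \<Rightarrow> nat \<Rightarrow> (nat \<Rightarrow> nat) \<Rightarrow> (nat \<Rightarrow> nat) \<times> (nat \<Rightarrow> nat)" where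
  "shuffle m j l \<phi> =
     (compose {..l} (\<lambda>i\<in>{..Suc m}. if i \<le> j then i else i - 1) \<phi>,
      compose {..l} (\<lambda>i\<in>{..Suc m}. if i \<le> j then 0 else 1) \<phi>)"

definition block :: "nat \<Rightarrow> nat \<Rightarrow> nat \<Rightarrow> ((nat \<Rightarrow> nat) \<times> (nat \<Rightarrow> nat)) set" where
  "block m j l = {(\<theta>, \<epsilon>). \<theta> \<in> Delta l m \<and> \<epsilon> \<in> Delta l 1 \<and>
     (\<forall>t \<le> l. (\<epsilon> t = 0 \<longrightarrow> \<theta> t \<le> j) \<and> (\<epsilon> t = 1 \<longrightarrow> j \<le> \<theta> t))}"

lemma shuffle_map:
  assumes "j \<le> m"
  shows "simplicial_map (simplex (Suc m)) (cylinder (simplex m)) (shuffle m j)"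
proof -
  have d: "(\<lambda>i\<in>{..Suc m}. if i \<le> j then i else i - 1) \<in> Delta (Suc m) m"
    by (rule DeltaI) (use assms in auto)
  have e: "(\<lambda>i\<in>{..Suc m}. if i \<le> j then 0 else 1) \<in> Delta (Suc m) 1"
    by (rule DeltaI) (use assms in auto)
  show ?thesis
    by (rule simplicial_mapI[OF simplicial_set_simplex
          simplicial_set_cylinder[OF simplicial_set_simplex]])
      (use Delta_compose[OF _ d] Delta_compose[OF _ e] in
        \<open>auto simp: shuffle_def compose_Delta_assoc\<close>)
qed

lemma shuffle_at:
  assumes "\<phi> \<in> Delta l (Suc m)" "t \<le> l" "shuffle m j l \<phi> = (\<theta>, \<epsilon>)"
  shows "\<theta> t = (if \<phi> t \<le> j then \<phi> t else \<phi> t - 1)" "\<epsilon> t = (if \<phi> t \<le> j then 0 else 1)"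
  using assms Delta_le[OF assms(1,2)] by (auto simp: shuffle_def compose_def)

lemma shuffle_inj:
  assumes "\<phi> \<in> Delta l (Suc m)" "\<psi> \<in> Delta l (Suc m)" "shuffle m j l \<phi> = shuffle m j l \<psi>"
  shows "\<phi> = \<psi>"
proof (rule Delta_eqI[OF assms(1,2)])
  fix t assume t: "t \<le> l"
  obtain \<theta> \<epsilon> where s: "shuffle m j l \<phi> = (\<theta>, \<epsilon>)" by fastforce
  with assms have s': "shuffle m j l \<psi> = (\<theta>, \<epsilon>)" by simp
  show "\<phi> t = \<psi> t"
    using trans[OF shuffle_at(1)[OF assms(1) t s, symmetric] shuffle_at(1)[OF assms(2) t s']]
      trans[OF shuffle_at(2)[OF assms(1) t s, symmetric] shuffle_at(2)[OF assms(2) t s']]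
    by (cases "\<phi> t \<le> j"; cases "\<psi> t \<le> j") simp_all
qed

lemma image_shuffle:
  assumes "j \<le> m"
  shows "shuffle m j l ` Delta l (Suc m) = block m j l"
proof (rule set_eqI, rule iffI)
  fix z assume "z \<in> shuffle m j l ` Delta l (Suc m)"
  then obtain \<phi> where \<phi>: "\<phi> \<in> Delta l (Suc m)" "z = shuffle m j l \<phi>" by auto
  obtain \<theta> \<epsilon> where s: "shuffle m j l \<phi> = (\<theta>, \<epsilon>)" by fastforce
  show "z \<in> block m j l"
    using map_cell[OF shuffle_map[OF assms], of \<phi> l] \<phi> s shuffle_at[OF \<phi>(1) _ s]
    by (auto simp: block_def)
next
  fix z assume "z \<in> block m j l"
  then obtain \<theta> \<epsilon> where z: "z = (\<theta>, \<epsilon>)" and \<theta>: "\<theta> \<in> Delta l m" and \<epsilon>: "\<epsilon> \<in> Delta l 1"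
    and b: "\<And>t. t \<le> l \<Longrightarrow> \<epsilon> t = 0 \<Longrightarrow> \<theta> t \<le> j" "\<And>t. t \<le> l \<Longrightarrow> \<epsilon> t = 1 \<Longrightarrow> j \<le> \<theta> t"
    by (auto simp: block_def)
  have \<epsilon>01: "\<epsilon> t = 0 \<or> \<epsilon> t = 1" if "t \<le> l" for t
    using Delta_le[OF \<epsilon> that] by auto
  \<comment> \<open>A vertex \<open>(i, e)\<close> of the path stands at position
    \<open>i + e\<close> of it, whence this preimage.\<close>
  define \<phi> where "\<phi> = (\<lambda>t\<in>{..l}. \<theta> t + \<epsilon> t)"
  have \<phi>: "\<phi> \<in> Delta l (Suc m)"
  proof (rule DeltaI)
    fix i assume "i \<le> l"
    then show "\<phi> i \<le> Suc m"
      using Delta_le[OF \<theta>, of i] Delta_le[OF \<epsilon>, of i] by (simp add: \<phi>_def)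
  next
    fix i i' assume "i \<le> i'" "i' \<le> l"
    then show "\<phi> i \<le> \<phi> i'"
      using Delta_mono[OF \<theta>, of i i'] Delta_mono[OF \<epsilon>, of i i'] by (simp add: \<phi>_def)
  qed (simp add: \<phi>_def)
  obtain \<theta>' \<epsilon>' where s: "shuffle m j l \<phi> = (\<theta>', \<epsilon>')" by fastforce
  have "(\<theta>', \<epsilon>') \<in> cells (cylinder (simplex m)) l"
    using map_cell[OF shuffle_map[OF assms], of \<phi> l] \<phi> s by simp
  then have "\<theta>' \<in> Delta l m" "\<epsilon>' \<in> Delta l 1" by auto
  moreover have "\<theta>' t = \<theta> t \<and> \<epsilon>' t = \<epsilon> t" if "t \<le> l" for t
    using shuffle_at[OF \<phi> that s] \<epsilon>01[OF that] b[OF that] that by (auto simp: \<phi>_def)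
  ultimately have "\<theta>' = \<theta>" "\<epsilon>' = \<epsilon>"
    using \<theta> \<epsilon> Delta_eqI by metis+
  then show "z \<in> shuffle m j l ` Delta l (Suc m)" using s z \<phi> by force
qed

lemma subcomplex_block: "subcomplex (cylinder (simplex m)) (block m j)"
proof (rule subcomplexI)
  fix k l \<phi> x assume "\<phi> \<in> Delta k l" "x \<in> block m j l"
  then show "restr (cylinder (simplex m)) k l \<phi> x \<in> block m j k"
    using Delta_compose[of \<phi> k l] Delta_le[of \<phi> k l] by (auto simp: block_def compose_def)
qed (auto simp: block_def)

text \<open>The column where the level changes is the value of \<open>\<theta>\<close> at the last
  position still on level 0, and 0 if there is none.\<close>

lemma block_cover:
  assumes \<theta>: "\<theta> \<in> Delta l m" and \<epsilon>: "\<epsilon> \<in> Delta l 1"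
  obtains j where "j \<le> m" "(\<theta>, \<epsilon>) \<in> block m j l"
proof (cases "\<exists>t\<le>l. \<epsilon> t = 0")
  case False
  then have "(\<theta>, \<epsilon>) \<in> block m 0 l" using \<theta> \<epsilon> by (auto simp: block_def)
  then show thesis using that by blast
next
  case True
  let ?T = "{t. t \<le> l \<and> \<epsilon> t = 0}"
  define s where "s = Max ?T"
  have "s \<in> ?T" unfolding s_def by (rule Max_in) (use True in auto)
  moreover have "t \<le> s" if "t \<in> ?T" for t
    unfolding s_def by (rule Max_ge) (use that in auto)
  ultimately have s: "s \<le> l" "\<epsilon> s = 0" "\<And>t. t \<le> l \<Longrightarrow> \<epsilon> t = 0 \<Longrightarrow> t \<le> s" by auto
  have "s \<le> t" if "t \<le> l" "\<epsilon> t = 1" for t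
    using Delta_mono[OF \<epsilon>, of t s] s that by (metis nle_le not_one_le_zero)
  then have "(\<theta>, \<epsilon>) \<in> block m (\<theta> s) l"
    using \<theta> \<epsilon> s Delta_mono[OF \<theta>] by (auto simp: block_def)
  then show thesis using that Delta_le[OF \<theta> s(1)] by blast
qed

text \<open>\<open>shuffle m j\<close> exhibits the addition of the block as a pushout of a horn
  inclusion; the hypothesis \<open>horn\<close> says that only the interior and the face opposite
  \<open>k\<close> are new.\<close>

lemma llp_block:
  assumes p: "kan_fibration X Y p" and j: "j \<le> m" and k: "k \<le> Suc m"
    and M: "subcomplex (cylinder (simplex m)) M"
    and horn: "\<And>l \<phi>. \<phi> \<in> Delta l (Suc m) \<Longrightarrow>
      shuffle m j l \<phi> \<in> M l \<longleftrightarrow> \<phi> \<in> cells (horn (Suc m) k) l"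
  shows "llp ((cylinder (simplex m))\<lparr>cells := (\<lambda>l. M l \<union> block m j l)\<rparr>) M X Y p"
proof (rule llp_pushout)
  let ?P = "cylinder (simplex m)"
  let ?N = "\<lambda>l. M l \<union> block m j l"
  have P: "simplicial_set ?P"
    by (rule simplicial_set_cylinder[OF simplicial_set_simplex])
  have N: "subcomplex ?P ?N"
    by (rule subcomplex_Un[OF M subcomplex_block])
  show "subcomplex (?P\<lparr>cells := ?N\<rparr>) M"
    using M by (auto simp: subcomplex_def)
  show "simplicial_map (simplex (Suc m)) (?P\<lparr>cells := ?N\<rparr>) (shuffle m j)"
  proof (rule simplicial_mapI[OF simplicial_set_simplex simplicial_set_sub[OF P N]])
    show "shuffle m j l \<phi> \<in> cells (?P\<lparr>cells := ?N\<rparr>) l" if "\<phi> \<in> cells (simplex (Suc m)) l" for l \<phi>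
      using that image_shuffle[OF j, of l] by auto
  qed (use map_restr[OF shuffle_map[OF j]] in auto)
  show "x \<in> shuffle m j l ` cells (simplex (Suc m)) l"
    if "x \<in> cells (?P\<lparr>cells := ?N\<rparr>) l" "x \<notin> M l" for l x
    using that image_shuffle[OF j, of l] by auto
  have "(\<lambda>l. {\<phi> \<in> cells (simplex (Suc m)) l. shuffle m j l \<phi> \<in> M l}) = cells (horn (Suc m) k)"
    using horn by (auto simp: fun_eq_iff cells_horn)
  then show "llp (simplex (Suc m)) (\<lambda>l. {\<phi> \<in> cells (simplex (Suc m)) l. shuffle m j l \<phi> \<in> M l}) X Y p"
    using p k by (simp add: kan_fibration_llp)
qed (use shuffle_inj in auto)

text \<open>\<open>I\<close> records the blocks already attached to the box. Consecutive blocks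
  share a face; the end 0 is a face of the last block and the end 1 a face of the first. So for
  \<open>e = 0\<close> the blocks are attached downwards from \<open>m\<close>, for
  \<open>e = 1\<close> upwards from 0.\<close>

definition stage :: "nat \<Rightarrow> nat \<Rightarrow> nat set \<Rightarrow> nat \<Rightarrow> ((nat \<Rightarrow> nat) \<times> (nat \<Rightarrow> nat)) set" where
  "stage e m I l = open_box e (simplex m) (boundary m) l \<union> (\<Union>i\<in>I. block m i l)"

lemma subcomplex_stage: "subcomplex (cylinder (simplex m)) (stage e m I)"
  unfolding stage_def
  by (intro subcomplex_Un subcomplex_UN subcomplex_open_box simplicial_set_simplex
      subcomplex_boundary subcomplex_block)

lemma stage_cover: "stage e m {..m} = cells (cylinder (simplex m))"
proof (rule ext, rule set_eqI, rule iffI)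
  fix l x assume "x \<in> stage e m {..m} l"
  then show "x \<in> cells (cylinder (simplex m)) l"
    by (rule subcomplex_cell[OF subcomplex_stage])
next
  fix l x assume "x \<in> cells (cylinder (simplex m)) l"
  then obtain \<theta> \<epsilon> where x: "x = (\<theta>, \<epsilon>)" "\<theta> \<in> Delta l m" "\<epsilon> \<in> Delta l 1" by auto
  then show "x \<in> stage e m {..m} l"
    using block_cover[OF x(2,3)] by (auto simp: stage_def)
qed

text \<open>\<open>j\<close> and \<open>Suc j\<close> both project to the vertex \<open>j\<close>,
  so a simplex that misses at most one of them, and nothing else, still projects onto all of
  \<open>[m]\<close>.\<close>

lemma shuffle_onto:
  assumes \<phi>: "\<phi> \<in> Delta l (Suc m)" and k: "k = j \<or> k = Suc j"
    and "\<phi> \<notin> cells (horn (Suc m) k) l" and s: "shuffle m j l \<phi> = (\<theta>, \<epsilon>)" and "i \<le> m"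
  shows "i \<in> \<theta> ` {..l}"
proof -
  have hit: "\<exists>t\<le>l. \<phi> t = i" if "i \<le> Suc m" "i \<noteq> k" for i
    using assms that by (auto simp: cells_horn)
  consider "i < j" | "i = j" "k = j" | "i = j" "k = Suc j" | "i > j" using k by linarith
  then have "\<exists>t\<le>l. \<theta> t = i"
  proof cases
    case 1
    then obtain t where "t \<le> l" "\<phi> t = i" using hit[of i] \<open>i \<le> m\<close> k by auto
    then show ?thesis using shuffle_at(1)[OF \<phi> _ s, of t] 1 by auto
  next
    case 2
    then obtain t where "t \<le> l" "\<phi> t = Suc i" using hit[of "Suc i"] \<open>i \<le> m\<close> by auto
    then show ?thesis using shuffle_at(1)[OF \<phi> _ s, of t] 2 by auto
  next
    case 3
    then obtain t where "t \<le> l" "\<phi> t = i" using hit[of i] \<open>i \<le> m\<close> by auto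
    then show ?thesis using shuffle_at(1)[OF \<phi> _ s, of t] 3 by auto
  next
    case 4
    then obtain t where "t \<le> l" "\<phi> t = Suc i" using hit[of "Suc i"] \<open>i \<le> m\<close> k by auto
    then show ?thesis using shuffle_at(1)[OF \<phi> _ s, of t] 4 by auto
  qed
  then show ?thesis by auto
qed

text \<open>The faces of \<open>shuffle m j\<close> opposite \<open>j\<close> and \<open>Suc j\<close>, which are not covered here, are
  shared with the neighbouring shuffles or are the two ends of the prism.\<close>

lemma shuffle_boundary:
  assumes \<phi>: "\<phi> \<in> Delta l (Suc m)" and "j \<le> m"
    and i: "i \<le> Suc m" "i \<notin> \<phi> ` {..l}" "i < j \<or> Suc j < i"
  shows "shuffle m j l \<phi> \<in> open_box e (simplex m) (boundary m) l"
proof -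
  obtain \<theta> \<epsilon> where s: "shuffle m j l \<phi> = (\<theta>, \<epsilon>)" by fastforce
  define i' where "i' = (if i < j then i else i - 1)"
  have "i' \<noteq> \<theta> t" if "t \<le> l" for t
  proof -
    have "\<phi> t \<noteq> i" using i that by auto
    then show ?thesis
      using shuffle_at(1)[OF \<phi> that s] i(3)
      by (cases "\<phi> t \<le> j"; cases "i < j") (auto simp: i'_def)
  qed
  moreover have "i' \<le> m" using i \<open>j \<le> m\<close> by (auto simp: i'_def)
  moreover have "\<theta> \<in> Delta l m" "\<epsilon> \<in> Delta l 1"
    using map_cell[OF shuffle_map[OF \<open>j \<le> m\<close>], of \<phi> l] \<phi> s by auto
  ultimately show ?thesis using s by (auto simp: open_box_def boundary_def)
qed

text \<open>The face opposite \<open>Suc j\<close> is shared with block \<open>Suc j\<close>, or is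
  the end 0 if \<open>j = m\<close>; the face opposite \<open>j\<close> is the free one and so
  indexes the horn. The remaining faces project into the boundary.\<close>

lemma shuffle_stage_0:
  assumes \<phi>: "\<phi> \<in> Delta l (Suc m)" and j: "j \<le> m"
  shows "shuffle m j l \<phi> \<in> stage 0 m {Suc j..m} l \<longleftrightarrow> \<phi> \<in> cells (horn (Suc m) j) l"
proof -
  obtain \<theta> \<epsilon> where s: "shuffle m j l \<phi> = (\<theta>, \<epsilon>)" by fastforce
  have \<theta>\<epsilon>: "\<theta> \<in> Delta l m" "\<epsilon> \<in> Delta l 1"
    using map_cell[OF shuffle_map[OF j], of \<phi> l] \<phi> s by auto
  note at = shuffle_at[OF \<phi> _ s]
  show ?thesis
  proof
    assume "\<phi> \<in> cells (horn (Suc m) j) l"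
    then obtain i where i: "i \<le> Suc m" "i \<noteq> j" "i \<notin> \<phi> ` {..l}" by (auto simp: cells_horn)
    show "shuffle m j l \<phi> \<in> stage 0 m {Suc j..m} l"
    proof (cases "i = Suc j")
      case False
      then have "i < j \<or> Suc j < i" using i by linarith
      then show ?thesis
        using shuffle_boundary[OF \<phi> j i(1,3), of 0] by (simp add: stage_def)
    next
      case True
      have ne: "\<phi> t \<noteq> Suc j" if "t \<le> l" for t using True i(3) that by (metis atMost_iff imageI)
      show ?thesis
      proof (cases "j = m")
        case True
        have "\<epsilon> = (\<lambda>t\<in>{..l}. 0)"
          by (rule Delta_eqI[OF \<theta>\<epsilon>(2)])
            (use at(2) ne Delta_le[OF \<phi>] True in \<open>auto simp: Delta_const_iff le_Suc_eq\<close>)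
        then show ?thesis using s \<theta>\<epsilon> by (simp add: stage_def open_box_def)
      next
        case False
        have "(\<epsilon> t = 0 \<longrightarrow> \<theta> t \<le> Suc j) \<and> (\<epsilon> t = 1 \<longrightarrow> Suc j \<le> \<theta> t)" if "t \<le> l" for t
          using at[OF that] ne[OF that] by auto
        then have "(\<theta>, \<epsilon>) \<in> block m (Suc j) l" using \<theta>\<epsilon> by (auto simp: block_def)
        then show ?thesis using s False j by (auto simp: stage_def)
      qed
    qed
  next
    assume st: "shuffle m j l \<phi> \<in> stage 0 m {Suc j..m} l"
    show "\<phi> \<in> cells (horn (Suc m) j) l"
    proof (rule ccontr)
      assume no: "\<phi> \<notin> cells (horn (Suc m) j) l"
      then have "\<theta> \<notin> boundary m l"
        using shuffle_onto[OF \<phi> _ no s] by (auto simp: boundary_def)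
      \<comment> \<open>Outside the horn \<open>\<phi>\<close> hits \<open>Suc j\<close>, which sits
        on level 1 over \<open>j\<close>; this excludes the end 0 and every block with index above
        \<open>j\<close>.\<close>
      moreover obtain t where t: "t \<le> l" "\<phi> t = Suc j"
        using no \<phi> j by (auto simp: cells_horn image_iff)
      then have "\<epsilon> t = 1" "\<theta> t = j" using at[OF t(1)] by auto
      ultimately show False using st s t(1) by (auto simp: stage_def open_box_def block_def)
    qed
  qed
qed

text \<open>The mirror image: the face opposite \<open>j\<close> is shared with block
  \<open>j - 1\<close>, or is the end 1 if \<open>j = 0\<close>, and the face opposite
  \<open>Suc j\<close> is free.\<close>

lemma shuffle_stage_1:
  assumes \<phi>: "\<phi> \<in> Delta l (Suc m)" and j: "j \<le> m"
  shows "shuffle m j l \<phi> \<in> stage 1 m {..<j} l \<longleftrightarrow> \<phi> \<in> cells (horn (Suc m) (Suc j)) l"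
proof -
  obtain \<theta> \<epsilon> where s: "shuffle m j l \<phi> = (\<theta>, \<epsilon>)" by fastforce
  have \<theta>\<epsilon>: "\<theta> \<in> Delta l m" "\<epsilon> \<in> Delta l 1"
    using map_cell[OF shuffle_map[OF j], of \<phi> l] \<phi> s by auto
  note at = shuffle_at[OF \<phi> _ s]
  show ?thesis
  proof
    assume "\<phi> \<in> cells (horn (Suc m) (Suc j)) l"
    then obtain i where i: "i \<le> Suc m" "i \<noteq> Suc j" "i \<notin> \<phi> ` {..l}" by (auto simp: cells_horn)
    show "shuffle m j l \<phi> \<in> stage 1 m {..<j} l"
    proof (cases "i = j")
      case False
      then have "i < j \<or> Suc j < i" using i by linarith
      then show ?thesis
        using shuffle_boundary[OF \<phi> j i(1,3), of 1] by (simp add: stage_def)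
    next
      case True
      have ne: "\<phi> t \<noteq> j" if "t \<le> l" for t using True i(3) that by (metis atMost_iff imageI)
      show ?thesis
      proof (cases j)
        case 0
        have "\<epsilon> = (\<lambda>t\<in>{..l}. 1)"
          by (rule Delta_eqI[OF \<theta>\<epsilon>(2)])
            (use at(2) ne 0 in \<open>auto simp: Delta_const_iff\<close>)
        then show ?thesis using s \<theta>\<epsilon> by (simp add: stage_def open_box_def)
      next
        case (Suc j')
        have "(\<epsilon> t = 0 \<longrightarrow> \<theta> t \<le> j') \<and> (\<epsilon> t = 1 \<longrightarrow> j' \<le> \<theta> t)" if "t \<le> l" for t
          using at[OF that] ne[OF that] Suc by auto
        then have "(\<theta>, \<epsilon>) \<in> block m j' l" using \<theta>\<epsilon> by (auto simp: block_def)
        then show ?thesis using s Suc by (auto simp: stage_def)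
      qed
    qed
  next
    assume st: "shuffle m j l \<phi> \<in> stage 1 m {..<j} l"
    show "\<phi> \<in> cells (horn (Suc m) (Suc j)) l"
    proof (rule ccontr)
      assume no: "\<phi> \<notin> cells (horn (Suc m) (Suc j)) l"
      then have "\<theta> \<notin> boundary m l"
        using shuffle_onto[OF \<phi> _ no s] by (auto simp: boundary_def)
      moreover have "j \<in> \<phi> ` {..l}"
        using no[unfolded cells_horn] \<phi> le_SucI[OF j] n_not_Suc_n[of j] by blast
      then obtain t where t: "t \<le> l" "\<phi> t = j" by auto
      moreover have "\<epsilon> t = 0" "\<theta> t = j" using at[OF t(1)] t by auto
      ultimately show False using st s t(1) by (auto simp: stage_def open_box_def block_def)
    qed
  qed
qed

section \<open>Filling a prism block by block\<close>

lemma llp_stage_step: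
  assumes p: "kan_fibration X Y p" and j: "j \<le> m" and k: "k \<le> Suc m"
    and horn: "\<And>l \<phi>. \<phi> \<in> Delta l (Suc m) \<Longrightarrow>
      shuffle m j l \<phi> \<in> stage e m I l \<longleftrightarrow> \<phi> \<in> cells (horn (Suc m) k) l"
    and llp: "llp (cylinder (simplex m)) (stage e m (insert j I)) X Y p"
  shows "llp (cylinder (simplex m)) (stage e m I) X Y p"
proof (rule llp_trans[OF subcomplex_stage _ _ llp])
  have "stage e m (insert j I) = (\<lambda>l. stage e m I l \<union> block m j l)"
    by (auto simp: stage_def fun_eq_iff)
  then show "llp ((cylinder (simplex m))\<lparr>cells := stage e m (insert j I)\<rparr>) (stage e m I) X Y p"
    using llp_block[OF p j k subcomplex_stage horn] by simp
qed (auto simp: stage_def)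

text \<open>The induction runs backwards from the full prism, where lifting is trivial, and takes
  away one block at a time; the order of the blocks dictates which horn each of them is attached
  along.\<close>

lemma llp_prism:
  assumes p: "kan_fibration X Y p" and e: "e = 0 \<or> e = 1"
  shows "llp (cylinder (simplex m)) (open_box e (simplex m) (boundary m)) X Y p"
proof -
  have all: "llp (cylinder (simplex m)) (stage e m {..m}) X Y p"
    using llp_refl stage_cover by metis
  have "llp (cylinder (simplex m)) (stage e m {}) X Y p"
    using e
  proof
    assume e0: "e = 0"
    have "llp (cylinder (simplex m)) (stage e m {j..m}) X Y p" if "j \<le> Suc m" for j
      using that
    proof (induction j)
      case 0
      then show ?case using all by (simp add: atLeast0AtMost)
    next
      case (Suc j)
      then have "j \<le> m" "j \<le> Suc m" "insert j {Suc j..m} = {j..m}" by auto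
      then show ?case
        using llp_stage_step[OF p _ _ shuffle_stage_0, of j m] Suc.IH e0 by simp
    qed
    from this[of "Suc m"] show ?thesis by simp
  next
    assume e1: "e = 1"
    have "llp (cylinder (simplex m)) (stage e m {..<Suc m - d}) X Y p" if "d \<le> Suc m" for d
      using that
    proof (induction d)
      case 0
      then show ?case using all by (simp add: lessThan_Suc_atMost)
    next
      case (Suc d)
      define j where "j = Suc m - Suc d"
      with Suc.prems have "j \<le> m" "Suc j \<le> Suc m" "insert j {..<j} = {..<Suc m - d}" by auto
      then have "llp (cylinder (simplex m)) (stage e m {..<j}) X Y p"
        using llp_stage_step[OF p _ _ shuffle_stage_1, of j m] Suc e1 by simp
      then show ?case by (simp add: j_def)
    qed
    from this[of "Suc m"] show ?thesis by simp
  qed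
  moreover have "stage e m {} = open_box e (simplex m) (boundary m)"
    by (simp add: stage_def fun_eq_iff)
  ultimately show ?thesis by simp
qed

section \<open>Attaching a cell of least dimension\<close>

locale minimal_new_cell =
  fixes K :: "'k sset" and M :: "nat \<Rightarrow> 'k set" and m :: nat and x :: 'k
  assumes K: "simplicial_set K" and M: "subcomplex K M"
    and x: "x \<in> cells K m" "x \<notin> M m"
    and minimal: "\<And>l y. l < m \<Longrightarrow> y \<in> cells K l \<Longrightarrow> y \<in> M l"
begin

text \<open>An arrow that hits all vertices has a section, and restricting along it recovers
  \<open>x\<close>; any other arrow factors through a face, and the faces of \<open>x\<close> lie in
  \<open>M\<close> for reasons of dimension. Minimality thus stands in for nondegeneracy of
  \<open>x\<close>.\<close>

lemma restr_new_iff: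
  assumes \<theta>: "\<theta> \<in> Delta l m"
  shows "restr K l m \<theta> x \<in> M l \<longleftrightarrow> \<theta> \<in> boundary m l"
proof
  assume xt: "restr K l m \<theta> x \<in> M l"
  show "\<theta> \<in> boundary m l"
  proof (rule ccontr)
    assume "\<theta> \<notin> boundary m l"
    then have "{..m} \<subseteq> \<theta> ` {..l}" using \<theta> by (auto simp: boundary_def)
    then obtain \<sigma> where \<sigma>: "\<sigma> \<in> Delta m l" "compose {..m} \<theta> \<sigma> = (\<lambda>j\<in>{..m}. j)"
      using Delta_section[OF \<theta> _ le0] by blast
    have "x = restr K m l \<sigma> (restr K l m \<theta> x)"
      using restr_compose[OF K \<sigma>(1) \<theta> x(1)] restr_id[OF K x(1)] \<sigma>(2) by simp
    then show False using subcomplex_restr[OF M \<sigma>(1) xt] x(2) by simp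
  qed
next
  assume "\<theta> \<in> boundary m l"
  then obtain j where j: "j \<le> m" "j \<notin> \<theta> ` {..l}" by (auto simp: boundary_def)
  obtain m' \<phi> where m': "m = Suc m'" "\<phi> \<in> Delta l m'" "\<theta> = compose {..l} (face m' j) \<phi>"
    by (rule Delta_factor_face[OF \<theta> j])
  have f: "face m' j \<in> Delta m' m" using face_Delta m'(1) by simp
  have "restr K m' m (face m' j) x \<in> M m'"
    using minimal restr_cell[OF K f x(1)] m'(1) by simp
  then show "restr K l m \<theta> x \<in> M l"
    using subcomplex_restr[OF M m'(2)] restr_compose[OF K m'(2) f x(1)] m'(3) by simp
qed

text \<open>Take the section of \<open>\<theta>\<close> through \<open>i\<close>. The endomorphism
  \<open>compose {..m} \<theta>' \<sigma>\<close> fixes \<open>x\<close>, hence lies outside the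
  boundary and is the identity; at \<open>\<theta> i\<close> this says
  \<open>\<theta>' i = \<theta> i\<close>.\<close>

lemma restr_new_inj:
  assumes \<theta>: "\<theta> \<in> Delta l m" and \<theta>': "\<theta>' \<in> Delta l m"
    and eq: "restr K l m \<theta> x = restr K l m \<theta>' x" and new: "restr K l m \<theta> x \<notin> M l"
  shows "\<theta> = \<theta>'"
proof (rule Delta_eqI[OF \<theta> \<theta>'])
  fix i assume i: "i \<le> l"
  have "{..m} \<subseteq> \<theta> ` {..l}" using restr_new_iff[OF \<theta>] new \<theta> by (auto simp: boundary_def)
  then obtain \<sigma> where \<sigma>: "\<sigma> \<in> Delta m l" "compose {..m} \<theta> \<sigma> = (\<lambda>j\<in>{..m}. j)" "\<sigma> (\<theta> i) = i"
    using Delta_section[OF \<theta> _ i] by blast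
  have "x = restr K m m (compose {..m} \<theta>' \<sigma>) x"
    using restr_compose[OF K \<sigma>(1) \<theta> x(1)] restr_compose[OF K \<sigma>(1) \<theta>' x(1)] eq
      restr_id[OF K x(1)] \<sigma>(2) by simp
  moreover have c: "compose {..m} \<theta>' \<sigma> \<in> Delta m m" by (rule Delta_compose[OF \<sigma>(1) \<theta>'])
  ultimately have "compose {..m} \<theta>' \<sigma> \<notin> boundary m m"
    using restr_new_iff x(2) by metis
  then have "compose {..m} \<theta>' \<sigma> = (\<lambda>j\<in>{..m}. j)"
    using Delta_endo_surj_id[OF c] c by (auto simp: boundary_def)
  from fun_cong[OF this, of "\<theta> i"] show "\<theta> i = \<theta>' i"
    using \<sigma>(3) Delta_le[OF \<theta> i] by (simp add: compose_def)
qed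

definition adjoined :: "nat \<Rightarrow> 'k set" where
  "adjoined l = M l \<union> (\<lambda>\<theta>. restr K l m \<theta> x) ` Delta l m"

lemma subcomplex_adjoined: "subcomplex K adjoined"
proof (rule subcomplexI)
  fix l y assume "y \<in> adjoined l"
  then show "y \<in> cells K l"
    using subcomplex_cell[OF M, of y l] restr_cell[OF K _ x(1)] by (auto simp: adjoined_def)
next
  fix k l \<phi> y assume \<phi>: "\<phi> \<in> Delta k l" and "y \<in> adjoined l"
  then show "restr K k l \<phi> y \<in> adjoined k"
    using subcomplex_restr[OF M \<phi>, of y] restr_compose[OF K \<phi> _ x(1), symmetric]
      Delta_compose[OF \<phi>] by (auto simp: adjoined_def)
qed

lemma new_in_adjoined: "x \<in> adjoined m"
  unfolding adjoined_def using imageI[OF Delta_id, of "\<lambda>\<theta>. restr K m m \<theta> x" m] restr_id[OF K x(1)]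
  by simp

text \<open>Attaching \<open>x\<close> is a pushout of a boundary inclusion; taken over the interval
  it becomes a pushout of the open box in a prism, which \<open>llp_prism\<close> handles.\<close>

lemma llp_adjoined:
  assumes p: "kan_fibration X Y p" and e: "e = 0 \<or> e = 1"
  shows "llp ((cylinder K)\<lparr>cells := open_box e K adjoined\<rparr>) (open_box e K M) X Y p"
proof (rule llp_pushout)
  let ?N = "open_box e K adjoined"
  let ?K = "(cylinder K)\<lparr>cells := ?N\<rparr>"
  let ?J = "cylinder (simplex m)"
  let ?s = "\<lambda>l (\<theta>, \<epsilon>). (restr K l m \<theta> x, \<epsilon>)"
  have N: "subcomplex (cylinder K) ?N"
    by (rule subcomplex_open_box[OF K subcomplex_adjoined])
  have MN: "open_box e K M l \<subseteq> ?N l" for l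
    by (auto simp: open_box_def adjoined_def)
  show "subcomplex ?K (open_box e K M)"
    using subcomplex_open_box[OF K M, of e] MN by (auto simp: subcomplex_def)
  show "simplicial_map ?J ?K ?s"
  proof (rule simplicial_mapI)
    show "simplicial_set ?J" by (rule simplicial_set_cylinder[OF simplicial_set_simplex])
    show "simplicial_set ?K" by (rule simplicial_set_sub[OF simplicial_set_cylinder[OF K] N])
  qed (use restr_cell[OF K _ x(1)] restr_compose[OF K _ _ x(1)] in
        \<open>auto simp: open_box_def adjoined_def\<close>)
  show "y = y'" if "y \<in> cells ?J l" "y' \<in> cells ?J l" "?s l y = ?s l y'" "?s l y \<notin> open_box e K M l"
    for l y y'
    using that restr_new_inj restr_cell[OF K _ x(1)] by (auto simp: open_box_def)
  show "z \<in> ?s l ` cells ?J l" if "z \<in> cells ?K l" "z \<notin> open_box e K M l" for l z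
    using that by (auto simp: open_box_def adjoined_def image_iff)
  have "(\<lambda>l. {y \<in> cells ?J l. ?s l y \<in> open_box e K M l}) = open_box e (simplex m) (boundary m)"
    using restr_new_iff restr_cell[OF K _ x(1)] by (auto simp: open_box_def fun_eq_iff)
  then show "llp ?J (\<lambda>l. {y \<in> cells ?J l. ?s l y \<in> open_box e K M l}) X Y p"
    using llp_prism[OF p e] by simp
qed

end

text \<open>The end \<open>e\<close> of a box contains every cell of \<open>K\<close>, so only the
  opposite end shows which cells lie in \<open>M\<close>. This makes the growth in the Zorn argument
  strict.\<close>

lemma open_box_inj:
  assumes "e = 0 \<or> e = 1" "x \<in> cells K n"
  shows "(x, \<lambda>i\<in>{..n}. 1 - e) \<in> open_box e K M n \<longleftrightarrow> x \<in> M n"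
proof -
  have "(\<lambda>i\<in>{..n}. 1 - e) \<noteq> (\<lambda>i\<in>{..n}. e)"
    using assms(1) by (auto dest: fun_cong[of _ _ 0])
  then show ?thesis using assms by (auto simp: open_box_def Delta_const_iff)
qed

text \<open>Zorn's lemma over the open boxes on larger and larger subcomplexes of \<open>K\<close>;
  each step attaches a cell of the least dimension in which one is still missing.\<close>

lemma llp_cylinder:
  assumes p: "kan_fibration X Y p" and e: "e = 0 \<or> e = 1"
    and K: "simplicial_set K" and L: "subcomplex K L"
  shows "llp (cylinder K) (open_box e K L) X Y p"
proof (rule llp_Zorn[where C = "\<lambda>M. \<exists>M'. subcomplex K M' \<and> M = open_box e K M'"])
  show "simplicial_set (cylinder K)" by (rule simplicial_set_cylinder[OF K])
  show "subcomplex (cylinder K) (open_box e K L)" by (rule subcomplex_open_box[OF K L])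
  show "\<exists>M'. subcomplex K M' \<and> open_box e K L = open_box e K M'" using L by blast
next
  fix F assume F: "F \<noteq> {}" and "\<And>M. M \<in> F \<Longrightarrow> \<exists>M'. subcomplex K M' \<and> M = open_box e K M'"
  then obtain g where g: "\<And>M. M \<in> F \<Longrightarrow> subcomplex K (g M) \<and> M = open_box e K (g M)" by metis
  have "subcomplex K (\<lambda>n. \<Union>M\<in>F. g M n)" by (rule subcomplex_UN) (use g in blast)
  moreover have "(\<Union>M\<in>F. M n) = (\<Union>M\<in>F. open_box e K (g M) n)" for n
    using g by (intro SUP_cong) auto
  then have "(\<lambda>n. \<Union>M\<in>F. M n) = open_box e K (\<lambda>n. \<Union>M\<in>F. g M n)"
    using F by (auto simp: open_box_def fun_eq_iff)
  ultimately show "\<exists>M'. subcomplex K M' \<and> (\<lambda>n. \<Union>M\<in>F. M n) = open_box e K M'" by blast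
next
  fix M assume "\<exists>M'. subcomplex K M' \<and> M = open_box e K M'" and ne: "M \<noteq> cells (cylinder K)"
  then obtain M' where M': "subcomplex K M'" and M_eq: "M = open_box e K M'" by blast
  have "M' \<noteq> cells K"
  proof
    assume "M' = cells K"
    then have "M = cells (cylinder K)" using M_eq by (auto simp: open_box_def fun_eq_iff)
    with ne show False ..
  qed
  then have ex: "\<exists>m x. x \<in> cells K m \<and> x \<notin> M' m"
    using subcomplex_cell[OF M'] by blast
  define m where "m = (LEAST m. \<exists>x. x \<in> cells K m \<and> x \<notin> M' m)"
  have "\<exists>x. x \<in> cells K m \<and> x \<notin> M' m" unfolding m_def by (rule LeastI_ex[OF ex])
  then obtain x where x: "x \<in> cells K m" "x \<notin> M' m" by blast
  have "y \<in> M' l" if "l < m" "y \<in> cells K l" for l y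
    using not_less_Least[OF that(1)[unfolded m_def]] that(2) by blast
  then interpret minimal_new_cell K M' m x
    by unfold_locales (use K M' x in auto)
  let ?N = "open_box e K adjoined"
  have "x \<in> adjoined m" by (rule new_in_adjoined)
  then have "open_box e K M' \<noteq> ?N"
    using open_box_inj[OF e x(1), of M'] open_box_inj[OF e x(1), of adjoined] x(2) by auto
  then have "M \<noteq> ?N" using M_eq by simp
  moreover have "M n \<subseteq> ?N n" for n unfolding M_eq by (auto simp: open_box_def adjoined_def)
  moreover have "llp ((cylinder K)\<lparr>cells := ?N\<rparr>) M X Y p"
    unfolding M_eq by (rule llp_adjoined[OF p e])
  ultimately show "\<exists>N. subcomplex (cylinder K) N \<and> (\<exists>M'. subcomplex K M' \<and> N = open_box e K M') \<and>
      (\<forall>n. M n \<subseteq> N n) \<and> M \<noteq> N \<and> llp ((cylinder K)\<lparr>cells := N\<rparr>) M X Y p"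
    using subcomplex_open_box[OF K subcomplex_adjoined] subcomplex_adjoined by blast
qed

section \<open>Pulling back horn inclusions along Kan fibrations\<close>

definition pullback ::
  "'j sset \<Rightarrow> 'b sset \<Rightarrow> (nat \<Rightarrow> 'j \<Rightarrow> 'a) \<Rightarrow> (nat \<Rightarrow> 'b \<Rightarrow> 'a) \<Rightarrow> ('j \<times> 'b) sset" where
  "pullback J B v f =
     \<lparr>cells = (\<lambda>n. {(x, b). x \<in> cells J n \<and> b \<in> cells B n \<and> f n b = v n x}),
      restr = (\<lambda>m n \<theta> (x, b). (restr J m n \<theta> x, restr B m n \<theta> b))\<rparr>"

lemma cells_pullback [simp]:
  "(x, b) \<in> cells (pullback J B v f) n \<longleftrightarrow> x \<in> cells J n \<and> b \<in> cells B n \<and> f n b = v n x"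
  by (simp add: pullback_def)

lemma restr_pullback [simp]:
  "restr (pullback J B v f) m n \<theta> (x, b) = (restr J m n \<theta> x, restr B m n \<theta> b)"
  by (simp add: pullback_def)

lemma simplicial_set_pullback:
  assumes v: "simplicial_map J A v" and f: "simplicial_map B A f"
  shows "simplicial_set (pullback J B v f)"
proof (rule simplicial_setI)
  note ss = map_dom[OF v] map_dom[OF f]
  show "restr (pullback J B v f) m n \<theta> x \<in> cells (pullback J B v f) m"
    if "\<theta> \<in> Delta m n" "x \<in> cells (pullback J B v f) n" for m n \<theta> x
    using that by (cases x) (simp add: ss restr_cell map_restr[OF v] map_restr[OF f])
  show "restr (pullback J B v f) n n (\<lambda>i\<in>{..n}. i) x = x"
    if "x \<in> cells (pullback J B v f) n" for n x
    using that by (cases x) (simp add: ss restr_id)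
  show "restr (pullback J B v f) l n (compose {..l} \<theta> \<phi>) x =
      restr (pullback J B v f) l m \<phi> (restr (pullback J B v f) m n \<theta> x)"
    if "\<phi> \<in> Delta l m" "\<theta> \<in> Delta m n" "x \<in> cells (pullback J B v f) n" for l m n \<phi> \<theta> x
    using that by (cases x) (simp add: ss restr_compose)
qed

definition over :: "('j \<times> 'b) sset \<Rightarrow> (nat \<Rightarrow> 'j set) \<Rightarrow> nat \<Rightarrow> ('j \<times> 'b) set" where
  "over E L n = {z \<in> cells E n. fst z \<in> L n}"

lemma subcomplex_over:
  assumes "simplicial_set (pullback J B v f)" "subcomplex J L"
  shows "subcomplex (pullback J B v f) (over (pullback J B v f) L)"
proof (rule subcomplexI)
  fix m n \<theta> z assume \<theta>: "\<theta> \<in> Delta m n" and "z \<in> over (pullback J B v f) L n"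
  then show "restr (pullback J B v f) m n \<theta> z \<in> over (pullback J B v f) L m"
    using restr_cell[OF assms(1) \<theta>, of z] subcomplex_restr[OF assms(2) \<theta>]
    by (cases z) (auto simp: over_def)
qed (simp add: over_def)

text \<open>Lift the deformation \<open>H\<close> of \<open>J\<close> into \<open>L\<close> to a deformation \<open>G\<close> of the pullback into the
  part over \<open>L\<close>. A map defined over \<open>L\<close> is composed with \<open>G\<close>, extended to the whole
  cylinder, and restricted to the end where \<open>G\<close> is the identity.\<close>

lemma llp_pullback_of_deformation:
  assumes f: "kan_fibration B A f" and v: "simplicial_map J A v" and L: "subcomplex J L"
    and H: "simplicial_map (cylinder J) J H" and c: "c = 0 \<or> c = 1"
    and H_id: "\<And>n x. x \<in> cells J n \<Longrightarrow> H n (x, \<lambda>i\<in>{..n}. c) = x"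
    and H_into: "\<And>n x. x \<in> cells J n \<Longrightarrow> H n (x, \<lambda>i\<in>{..n}. 1 - c) \<in> L n"
    and H_L: "\<And>n x \<epsilon>. x \<in> L n \<Longrightarrow> \<epsilon> \<in> Delta n 1 \<Longrightarrow> H n (x, \<epsilon>) \<in> L n"
    and q: "kan_fibration X Y q"
  shows "llp (pullback J B v f) (over (pullback J B v f) L) X Y q"
proof (rule llpI)
  let ?E = "pullback J B v f"
  let ?C = "cylinder ?E"
  fix u w
  assume u: "simplicial_map (?E\<lparr>cells := over ?E L\<rparr>) X u" and w: "simplicial_map ?E Y w"
    and uw: "\<And>m z. z \<in> over ?E L m \<Longrightarrow> q m (u m z) = w m z"
  have f': "simplicial_map B A f" using f by (simp add: kan_fibration_def)
  have E: "simplicial_set ?E" by (rule simplicial_set_pullback[OF v f'])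
  note B = map_dom[OF f'] and C = simplicial_set_cylinder[OF E]
  have EL: "subcomplex ?E (over ?E L)" by (rule subcomplex_over[OF E L])
  have c': "1 - c = 0 \<or> 1 - c = 1" "c \<le> 1" using c by auto
  \<comment> \<open>With empty \<open>L\<close> the open box is just the end \<open>c\<close>, so
    \<open>G\<close> is prescribed only there, as the projection to \<open>B\<close>.\<close>
  have empty: "subcomplex ?E (\<lambda>_. {})" by (simp add: subcomplex_def)
  have snd: "simplicial_map (?C\<lparr>cells := open_box c ?E (\<lambda>_. {})\<rparr>) B (\<lambda>n z. snd (fst z))"
    by (rule simplicial_mapI[OF simplicial_set_sub[OF C subcomplex_open_box[OF E empty]] B])
      (auto simp: open_box_def)
  have "simplicial_map ?C (cylinder J) (\<lambda>n z. (fst (fst z), snd z))"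
    by (rule simplicial_mapI[OF C map_dom[OF H]]) auto
  from simplicial_map_comp[OF this H]
  have HE: "simplicial_map ?C J (\<lambda>n z. H n (fst (fst z), snd z))" .
  obtain G where G: "simplicial_map ?C B G"
    "\<And>n z. z \<in> open_box c ?E (\<lambda>_. {}) n \<Longrightarrow> G n z = snd (fst z)"
    "\<And>n z. z \<in> cells ?C n \<Longrightarrow> f n (G n z) = v n (H n (fst (fst z), snd z))"
    by (rule llpE[OF llp_cylinder[OF f c E empty] snd simplicial_map_comp[OF HE v]])
      (auto simp: open_box_def H_id)
  define D where "D n z = (H n (fst (fst z), snd z), G n z)" for n z
  have D: "simplicial_map ?C ?E D"
  proof (rule simplicial_mapI[OF C E])
    show "D n z \<in> cells ?E n" if "z \<in> cells ?C n" for n z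
      using map_cell[OF HE that] map_cell[OF G(1) that] G(3)[OF that] by (simp add: D_def)
    show "D m (restr ?C m n \<theta> z) = restr ?E m n \<theta> (D n z)"
      if "\<theta> \<in> Delta m n" "z \<in> cells ?C n" for m n \<theta> z
      using map_restr[OF HE that] map_restr[OF G(1) that] by (simp add: D_def)
  qed
  have D_id: "D n (z, \<lambda>i\<in>{..n}. c) = z" if "z \<in> cells ?E n" for n z
    using that G(2)[of "(z, \<lambda>i\<in>{..n}. c)" n] H_id[of "fst z" n] c'
    by (cases z) (simp add: D_def open_box_def Delta_const_iff)
  \<comment> \<open>At the end \<open>1 - c\<close> everything has been moved over \<open>L\<close>,
    and cells over \<open>L\<close> stay there throughout; so \<open>u\<close> is defined on the
    image of this box under \<open>D\<close>.\<close>
  let ?O = "open_box (1 - c) ?E (over ?E L)"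
  have O: "subcomplex ?C ?O" by (rule subcomplex_open_box[OF E EL])
  have D_L: "D n z \<in> over ?E L n" if "z \<in> ?O n" for n z
    using that subcomplex_cell[OF O that] map_cell[OF D, of z n] H_into[of "fst (fst z)" n]
      H_L[of "fst (fst z)" n "snd z"]
    by (cases z) (auto simp: D_def over_def open_box_def)
  have uD: "simplicial_map (?C\<lparr>cells := ?O\<rparr>) X (\<lambda>n z. u n (D n z))"
  proof (rule simplicial_mapI[OF simplicial_set_sub[OF C O] map_cod[OF u]])
    show "u n (D n z) \<in> cells X n" if "z \<in> cells (?C\<lparr>cells := ?O\<rparr>) n" for n z
      using map_cell[OF u, of "D n z" n] D_L that by simp
    show "u m (D m (restr (?C\<lparr>cells := ?O\<rparr>) m n \<theta> z)) = restr X m n \<theta> (u n (D n z))"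
      if "\<theta> \<in> Delta m n" "z \<in> cells (?C\<lparr>cells := ?O\<rparr>) n" for m n \<theta> z
      using map_restr[OF u that(1), of "D n z"] map_restr[OF D that(1), of z] D_L
        subcomplex_cell[OF O, of z n] that(2) by simp
  qed
  obtain h where h: "simplicial_map ?C X h" "\<And>n z. z \<in> ?O n \<Longrightarrow> h n z = u n (D n z)"
    "\<And>n z. z \<in> cells ?C n \<Longrightarrow> q n (h n z) = w n (D n z)"
    by (rule llpE[OF llp_cylinder[OF q c'(1) E EL] uD simplicial_map_comp[OF D w]])
      (use uw D_L in blast)+
  let ?w = "\<lambda>n z. h n (z, \<lambda>i\<in>{..n}. c)"
  have end_c: "simplicial_map ?E ?C (\<lambda>n z. (z, \<lambda>i\<in>{..n}. c))"
    by (rule simplicial_mapI[OF E C]) (use c' in \<open>auto simp: Delta_const_iff compose_const\<close>)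
  have "simplicial_map ?E X ?w" by (rule simplicial_map_comp[OF end_c h(1)])
  moreover have "?w n z = u n z" if "z \<in> over ?E L n" for n z
    using that h(2)[of "(z, \<lambda>i\<in>{..n}. c)" n] D_id[of z n] c'
    by (simp add: over_def open_box_def Delta_const_iff)
  moreover have "q n (?w n z) = w n z" if "z \<in> cells ?E n" for n z
    using h(3)[OF map_cell[OF end_c that]] D_id[OF that] by simp
  ultimately show "\<exists>w'. simplicial_map ?E X w' \<and> (\<forall>m. \<forall>z\<in>over ?E L m. w' m z = u m z) \<and>
      (\<forall>m. \<forall>z\<in>cells ?E m. q m (w' m z) = w m z)"
    by (intro exI[of _ ?w]) blast
qed

text \<open>A monotone homotopy needs comparable ends: \<open>min i k \<le> i\<close> puts the
  identity at level 1, and \<open>i \<le> max i k\<close> puts it at level 0, which determines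
  \<open>c\<close>. The first map omits the vertex \<open>n\<close> and serves for
  \<open>k < n\<close>; the second omits 0 and serves for \<open>k = n\<close>, where
  \<open>k\<close> is positive.\<close>

lemma horn_deformation:
  assumes "1 \<le> n" "k \<le> n"
  obtains H c where "c = 0 \<or> c = (1::nat)"
    "simplicial_map (cylinder (simplex n)) (simplex n) H"
    "\<And>m \<theta>. \<theta> \<in> Delta m n \<Longrightarrow> H m (\<theta>, \<lambda>i\<in>{..m}. c) = \<theta>"
    "\<And>m \<theta>. \<theta> \<in> Delta m n \<Longrightarrow> H m (\<theta>, \<lambda>i\<in>{..m}. 1 - c) \<in> cells (horn n k) m"
    "\<And>m \<theta> \<epsilon>. \<theta> \<in> cells (horn n k) m \<Longrightarrow> \<epsilon> \<in> Delta m 1 \<Longrightarrow> H m (\<theta>, \<epsilon>) \<in> cells (horn n k) m"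
proof -
  define H where "H c r m z = (\<lambda>i\<in>{..m}. if snd z i = c then fst z i else r (fst z i))"
    for c :: nat and r :: "nat \<Rightarrow> nat" and m and z :: "(nat \<Rightarrow> nat) \<times> (nat \<Rightarrow> nat)"
  note result = that
  \<comment> \<open>\<open>k\<close> is the only vertex that the homotopy can add, so a simplex
    missing some other vertex keeps missing it and the horn is preserved. Where \<open>r\<close> is
    applied throughout, \<open>j\<close> is missed and the horn is reached.\<close>
  have by_retraction: thesis
    if c: "c = 0 \<or> c = 1" and r: "\<And>j. r j = j \<or> r j = k"
      and j: "j \<le> n" "j \<noteq> k" "\<And>i. i \<le> n \<Longrightarrow> r i \<noteq> j"
      and mono: "\<And>m \<theta> \<epsilon>. \<theta> \<in> Delta m n \<Longrightarrow> \<epsilon> \<in> Delta m 1 \<Longrightarrow> H c r m (\<theta>, \<epsilon>) \<in> Delta m n"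
    for c r j
  proof (rule result)
    show "simplicial_map (cylinder (simplex n)) (simplex n) (H c r)"
      by (rule simplicial_mapI[OF simplicial_set_cylinder[OF simplicial_set_simplex]
            simplicial_set_simplex])
        (use mono Delta_le in \<open>auto simp: H_def compose_def fun_eq_iff\<close>)
    show "H c r m (\<theta>, \<lambda>i\<in>{..m}. c) = \<theta>" if \<theta>: "\<theta> \<in> Delta m n" for m \<theta>
      using Delta_undefined[OF \<theta>] by (auto simp: H_def fun_eq_iff)
    show "H c r m (\<theta>, \<lambda>i\<in>{..m}. 1 - c) \<in> cells (horn n k) m" if \<theta>: "\<theta> \<in> Delta m n" for m \<theta>
    proof -
      have "H c r m (\<theta>, \<lambda>i\<in>{..m}. 1 - c) i \<noteq> j" if "i \<le> m" for i
        using that c j(3)[OF Delta_le[OF \<theta> that]] by (auto simp: H_def)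
      then show ?thesis
        using mono[OF \<theta>, of "\<lambda>i\<in>{..m}. 1 - c"] j(1,2) by (force simp: cells_horn Delta_const_iff)
    qed
    show "H c r m (\<theta>, \<epsilon>) \<in> cells (horn n k) m"
      if \<theta>: "\<theta> \<in> cells (horn n k) m" and \<epsilon>: "\<epsilon> \<in> Delta m 1" for m \<theta> \<epsilon>
    proof -
      obtain i where i: "i \<le> n" "i \<noteq> k" "i \<notin> \<theta> ` {..m}" and "\<theta> \<in> Delta m n"
        using \<theta> by (auto simp: cells_horn)
      moreover have "H c r m (\<theta>, \<epsilon>) t \<noteq> i" if "t \<le> m" for t
        using r[of "\<theta> t"] i that by (auto simp: H_def)
      ultimately show ?thesis
        using mono \<epsilon> by (force simp: cells_horn)
    qed
  qed (rule c)
  show thesis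
  proof (cases "k = n")
    case False
    show thesis
    proof (rule by_retraction[of 1 "\<lambda>i. min i k" n])
      fix m \<theta> \<epsilon> assume \<theta>: "\<theta> \<in> Delta m n" and \<epsilon>: "\<epsilon> \<in> Delta m 1"
      show "H 1 (\<lambda>i. min i k) m (\<theta>, \<epsilon>) \<in> Delta m n"
      proof (rule DeltaI)
        fix i j assume "i \<le> j" "j \<le> m"
        then show "H 1 (\<lambda>i. min i k) m (\<theta>, \<epsilon>) i \<le> H 1 (\<lambda>i. min i k) m (\<theta>, \<epsilon>) j"
          using Delta_mono[OF \<theta>, of i j] Delta_mono[OF \<epsilon>, of i j] Delta_le[OF \<epsilon>, of j]
          by (auto simp: H_def)
      qed (use Delta_le[OF \<theta>] in \<open>auto simp: H_def intro: min.coboundedI1\<close>)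
    qed (use False assms in auto)
  next
    case True
    show thesis
    proof (rule by_retraction[of 0 "\<lambda>i. max i k" 0])
      fix m \<theta> \<epsilon> assume \<theta>: "\<theta> \<in> Delta m n" and \<epsilon>: "\<epsilon> \<in> Delta m 1"
      show "H 0 (\<lambda>i. max i k) m (\<theta>, \<epsilon>) \<in> Delta m n"
      proof (rule DeltaI)
        fix i j assume "i \<le> j" "j \<le> m"
        then show "H 0 (\<lambda>i. max i k) m (\<theta>, \<epsilon>) i \<le> H 0 (\<lambda>i. max i k) m (\<theta>, \<epsilon>) j"
          using Delta_mono[OF \<theta>, of i j] Delta_mono[OF \<epsilon>, of i j]
          by (auto simp: H_def)
      qed (use Delta_le[OF \<theta>] assms in \<open>auto simp: H_def\<close>)
    qed (use True assms in auto)
  qed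
qed

lemma llp_pullback_horn:
  assumes "1 \<le> n" "k \<le> n" "kan_fibration B A f" "simplicial_map (simplex n) A v"
    and "kan_fibration X Y q"
  shows "llp (pullback (simplex n) B v f) (over (pullback (simplex n) B v f) (cells (horn n k))) X Y q"
proof (rule horn_deformation[OF assms(1,2)])
  fix H and c :: nat
  assume c: "c = 0 \<or> c = 1"
    and H: "simplicial_map (cylinder (simplex n)) (simplex n) H"
    and H_id: "\<And>m \<theta>. \<theta> \<in> Delta m n \<Longrightarrow> H m (\<theta>, \<lambda>i\<in>{..m}. c) = \<theta>"
    and H_into: "\<And>m \<theta>. \<theta> \<in> Delta m n \<Longrightarrow> H m (\<theta>, \<lambda>i\<in>{..m}. 1 - c) \<in> cells (horn n k) m"
    and H_horn: "\<And>m \<theta> \<epsilon>. \<theta> \<in> cells (horn n k) m \<Longrightarrow> \<epsilon> \<in> Delta m 1 \<Longrightarrow>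
      H m (\<theta>, \<epsilon>) \<in> cells (horn n k) m"
  show ?thesis
    by (rule llp_pullback_of_deformation[OF assms(3,4) subcomplex_horn H c _ _ H_horn assms(5)])
      (simp_all only: cells_simplex H_id H_into)
qed

section \<open>The simplicial set of hereditarily natural trees\<close>

locale W_type =
  fixes A :: "'a sset" and B :: "'b sset" and f :: "nat \<Rightarrow> 'b \<Rightarrow> 'a"
  assumes f: "simplicial_map B A f"
begin

lemma sset_A: "simplicial_set A" and sset_B: "simplicial_set B"
  using map_cod[OF f] map_dom[OF f] by auto

abbreviation child :: "('a, 'b) tree \<Rightarrow> nat \<Rightarrow> (nat \<Rightarrow> nat) \<Rightarrow> 'b \<Rightarrow> ('a, 'b) tree" where
  "child w m \<beta> b \<equiv> the (branch w (m, \<beta>, b))"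

lemma Bhat_iff:
  "(m, \<beta>, b) \<in> Bhat A B f n a \<longleftrightarrow>
     \<beta> \<in> Delta m n \<and> b \<in> cells B m \<and> f m b = restr A m n \<beta> a"
  by (simp add: Bhat_def)

lemma Bhat_restr_right:
  assumes "a \<in> cells A n" "(m, \<beta>, b) \<in> Bhat A B f n a" "\<delta> \<in> Delta l m"
  shows "(l, compose {..l} \<beta> \<delta>, restr B l m \<delta> b) \<in> Bhat A B f n a"
  using assms by (auto simp: Bhat_iff Delta_compose restr_cell[OF sset_B] map_restr[OF f]
      restr_compose[OF sset_A])

lemma Bhat_restr_left:
  assumes "a \<in> cells A n" "\<gamma> \<in> Delta m n"
  shows "(l, \<beta>, b) \<in> Bhat A B f m (restr A m n \<gamma> a) \<longleftrightarrow>
    \<beta> \<in> Delta l m \<and> (l, compose {..l} \<gamma> \<beta>, b) \<in> Bhat A B f n a"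
  using assms by (auto simp: Bhat_iff Delta_compose restr_compose[OF sset_A])

lemma restr_W [simp]: "restr (W A B f) = tree_restr A B f"
  by (simp add: W_def)

lemma fibre_W: "w \<in> cells (W A B f) n \<Longrightarrow> fibre w = n"
  by (simp add: W_def)

lemma ran_branch:
  "dom t = S \<Longrightarrow> ran t = (\<lambda>i. the (t i)) ` S"
  by (force simp: ran_def dom_def image_iff)

text \<open>Unfolds the inductive set and the closure under subtrees by one level, so that trees can
  be handled through their roots and children, without induction.\<close>

lemma Node_in_W_iff:
  "Node n a t \<in> cells (W A B f) n \<longleftrightarrow>
     a \<in> cells A n \<and> dom t = Bhat A B f n a \<and> natural A B f (Node n a t) \<and>
     (\<forall>m \<beta> b. (m, \<beta>, b) \<in> Bhat A B f n a \<longrightarrow> the (t (m, \<beta>, b)) \<in> cells (W A B f) m)"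
  (is "?L \<longleftrightarrow> ?R")
proof
  assume L: ?L
  then have "Node n a t \<in> What A B f" and h: "hereditarily_natural A B f (Node n a t)"
    by (auto simp: W_def)
  then have 1: "a \<in> cells A n" "dom t = Bhat A B f n a" "\<forall>u \<in> ran t. u \<in> What A B f"
    by (auto elim: What.cases)
  have nat: "natural A B f (Node n a t)"
    using h by (auto simp: hereditarily_natural_def intro: subtree.intros)
  have "the (t (m, \<beta>, b)) \<in> cells (W A B f) m" if "(m, \<beta>, b) \<in> Bhat A B f n a" for m \<beta> b
  proof -
    have r: "the (t (m, \<beta>, b)) \<in> ran t" using that ran_branch[OF 1(2)] by blast
    moreover have "fibre (the (t (m, \<beta>, b))) = m"
      using nat that by (auto simp: natural_def)
    moreover have "hereditarily_natural A B f (the (t (m, \<beta>, b)))"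
      using h r by (auto simp: hereditarily_natural_def intro: subtree.intros)
    ultimately show ?thesis using 1(3) by (simp add: W_def)
  qed
  with 1 nat show ?R by blast
next
  assume R: ?R
  then have c: "u \<in> What A B f" "hereditarily_natural A B f u" if "u \<in> ran t" for u
    using that ran_branch[of t "Bhat A B f n a"] by (auto simp: W_def)
  have "natural A B f v" if "subtree v (Node n a t)" for v
    using that
  proof cases
    case 1
    then show ?thesis using R by simp
  next
    case (2 u)
    then show ?thesis using c(2)[of u] by (simp add: hereditarily_natural_def)
  qed
  then show ?L
    using R c by (auto simp: W_def hereditarily_natural_def intro: What.intros)
qed

lemma W_root: "w \<in> cells (W A B f) n \<Longrightarrow> root w \<in> cells A n"
  and W_dom: "w \<in> cells (W A B f) n \<Longrightarrow> dom (branch w) = Bhat A B f n (root w)"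
  and W_natural: "w \<in> cells (W A B f) n \<Longrightarrow> natural A B f w"
  and W_child: "w \<in> cells (W A B f) n \<Longrightarrow> (m, \<beta>, b) \<in> Bhat A B f n (root w) \<Longrightarrow>
    child w m \<beta> b \<in> cells (W A B f) m"
  using Node_in_W_iff[of n "root w" "branch w"] fibre_W[of w n] by (cases w; auto)+

lemma W_child_restr:
  assumes "w \<in> cells (W A B f) n" "(m, \<beta>, b) \<in> Bhat A B f n (root w)" "\<delta> \<in> Delta l m"
  shows "child w l (compose {..l} \<beta> \<delta>) (restr B l m \<delta> b) = tree_restr A B f l m \<delta> (child w m \<beta> b)"
  using W_natural[OF assms(1)] assms fibre_W[OF assms(1)] unfolding natural_def by blast

lemma W_eqI:
  assumes w: "w \<in> cells (W A B f) n" and w': "w' \<in> cells (W A B f) n" and root: "root w = root w'"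
    and child: "\<And>m \<beta> b. (m, \<beta>, b) \<in> Bhat A B f n (root w) \<Longrightarrow> child w m \<beta> b = child w' m \<beta> b"
  shows "w = w'"
proof (rule tree.expand, intro conjI)
  show "fibre w = fibre w'" using fibre_W w w' by simp
  show "branch w = branch w'"
  proof
    fix i :: "nat \<times> (nat \<Rightarrow> nat) \<times> 'b"
    obtain m \<beta> b where i: "i = (m, \<beta>, b)" by (cases i) auto
    show "branch w i = branch w' i"
    proof (cases "i \<in> Bhat A B f n (root w)")
      case True
      then have "i \<in> dom (branch w)" "i \<in> dom (branch w')" using W_dom w w' root by auto
      then show ?thesis using child[of m \<beta> b] True i by force
    next
      case False
      then have "i \<notin> dom (branch w)" "i \<notin> dom (branch w')" using W_dom w w' root by auto
      then show ?thesis by (simp add: domIff)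
    qed
  qed
qed (rule root)

lemma root_tree_restr: "root (tree_restr A B f m n \<gamma> w) = restr A m n \<gamma> (root w)"
  by (simp add: tree_restr_def Let_def)

lemma child_tree_restr:
  "(l, \<beta>, b) \<in> Bhat A B f m (restr A m n \<gamma> (root w)) \<Longrightarrow>
    child (tree_restr A B f m n \<gamma> w) l \<beta> b = child w l (compose {..l} \<gamma> \<beta>) b"
  by (simp add: tree_restr_def Let_def)

text \<open>Restriction only reindexes: each child of the restricted tree is a child of
  \<open>w\<close> itself, so no induction over the tree is involved, and naturality is inherited
  from \<open>w\<close> by associativity of composition.\<close>

lemma tree_restr_in_W:
  assumes w: "w \<in> cells (W A B f) n" and \<gamma>: "\<gamma> \<in> Delta m n"
  shows "tree_restr A B f m n \<gamma> w \<in> cells (W A B f) m"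
proof -
  let ?a = "restr A m n \<gamma> (root w)"
  let ?t = "(\<lambda>(l, \<beta>, b). branch w (l, compose {..l} \<gamma> \<beta>, b)) |` Bhat A B f m ?a"
  have a: "?a \<in> cells A m" by (rule restr_cell[OF sset_A \<gamma> W_root[OF w]])
  note left = Bhat_restr_left[OF W_root[OF w] \<gamma>]
  have t: "the (?t (l, \<beta>, b)) = child w l (compose {..l} \<gamma> \<beta>) b"
    if "(l, \<beta>, b) \<in> Bhat A B f m ?a" for l \<beta> b
    using that by simp
  have dom: "dom ?t = Bhat A B f m ?a"
    using left W_dom[OF w] by (fastforce simp: dom_def restrict_map_def split: if_splits)
  have child: "the (?t (l, \<beta>, b)) \<in> cells (W A B f) l"
    if "(l, \<beta>, b) \<in> Bhat A B f m ?a" for l \<beta> b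
    using t[OF that] W_child[OF w] left that by simp
  have "natural A B f (Node m ?a ?t)"
    unfolding natural_def tree.sel
  proof (intro ballI, clarify, intro conjI allI ballI)
    fix l \<beta> b assume i: "(l, \<beta>, b) \<in> Bhat A B f m ?a"
    show "fibre (the (?t (l, \<beta>, b))) = l" by (rule fibre_W[OF child[OF i]])
    fix k \<delta> assume \<delta>: "\<delta> \<in> Delta k l"
    have "compose {..k} \<gamma> (compose {..k} \<beta> \<delta>) = compose {..k} (compose {..l} \<gamma> \<beta>) \<delta>"
      using compose_Delta_assoc[OF \<delta>, of \<beta> m \<gamma>] i by (simp add: Bhat_iff)
    then show "the (?t (k, compose {..k} \<beta> \<delta>, restr B k l \<delta> b)) =
        tree_restr A B f k l \<delta> (the (?t (l, \<beta>, b)))"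
      using t[OF i] t[OF Bhat_restr_right[OF a i \<delta>]] W_child_restr[OF w _ \<delta>] left i by simp
  qed
  then have "Node m ?a ?t \<in> cells (W A B f) m"
    using Node_in_W_iff a dom child by blast
  then show ?thesis by (simp add: tree_restr_def Let_def)
qed

lemma simplicial_set_W: "simplicial_set (W A B f)"
proof (rule simplicial_setI)
  show cell: "restr (W A B f) m n \<theta> w \<in> cells (W A B f) m"
    if "\<theta> \<in> Delta m n" "w \<in> cells (W A B f) n" for m n \<theta> w
    using tree_restr_in_W that by simp
  show "restr (W A B f) n n (\<lambda>i\<in>{..n}. i) w = w" if w: "w \<in> cells (W A B f) n" for n w
  proof (rule W_eqI[OF cell[OF Delta_id w] w])
    show r: "root (restr (W A B f) n n (\<lambda>i\<in>{..n}. i) w) = root w"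
      unfolding restr_W root_tree_restr by (rule restr_id[OF sset_A W_root[OF w]])
    show "child (restr (W A B f) n n (\<lambda>i\<in>{..n}. i) w) m \<beta> b = child w m \<beta> b"
      if "(m, \<beta>, b) \<in> Bhat A B f n (root (restr (W A B f) n n (\<lambda>i\<in>{..n}. i) w))" for m \<beta> b
      using child_tree_restr[of m \<beta> b n n "\<lambda>i\<in>{..n}. i" w] that compose_id_Delta[of \<beta> m n]
      by (simp add: root_tree_restr Bhat_iff)
  qed
  show "restr (W A B f) l n (compose {..l} \<theta> \<phi>) w = restr (W A B f) l m \<phi> (restr (W A B f) m n \<theta> w)"
    if \<phi>: "\<phi> \<in> Delta l m" and \<theta>: "\<theta> \<in> Delta m n" and w: "w \<in> cells (W A B f) n" for l m n \<phi> \<theta> w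
  proof (rule W_eqI[OF cell[OF Delta_compose[OF \<phi> \<theta>] w] cell[OF \<phi> cell[OF \<theta> w]]])
    note comp = restr_compose[OF sset_A \<phi> \<theta> W_root[OF w]]
    show "root (restr (W A B f) l n (compose {..l} \<theta> \<phi>) w) =
        root (restr (W A B f) l m \<phi> (restr (W A B f) m n \<theta> w))"
      unfolding restr_W root_tree_restr by (rule comp)
    fix k \<beta> b
    assume "(k, \<beta>, b) \<in> Bhat A B f l (root (restr (W A B f) l n (compose {..l} \<theta> \<phi>) w))"
    then have i: "(k, \<beta>, b) \<in> Bhat A B f l (restr A l n (compose {..l} \<theta> \<phi>) (root w))"
      by (simp add: root_tree_restr)
    then have i': "(k, \<beta>, b) \<in> Bhat A B f l (restr A l m \<phi> (restr A m n \<theta> (root w)))"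
      by (simp add: comp)
    have \<beta>: "\<beta> \<in> Delta k l" "(k, compose {..k} \<phi> \<beta>, b) \<in> Bhat A B f m (restr A m n \<theta> (root w))"
      using i' Bhat_restr_left[OF restr_cell[OF sset_A \<theta> W_root[OF w]] \<phi>] by auto
    show "child (restr (W A B f) l n (compose {..l} \<theta> \<phi>) w) k \<beta> b =
        child (restr (W A B f) l m \<phi> (restr (W A B f) m n \<theta> w)) k \<beta> b"
      unfolding restr_W
      using child_tree_restr[OF i] child_tree_restr[of k \<beta> b l m \<phi> "tree_restr A B f m n \<theta> w"]
        child_tree_restr[OF \<beta>(2)] i' compose_Delta_assoc[OF \<beta>(1) \<phi>, of \<theta>]
      by (simp add: root_tree_restr)
  qed
qed

section \<open>Sets of trees as simplicial sets over \<open>A\<close>\<close>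

lemma root_map: "simplicial_map (W A B f) A (\<lambda>_. root)"
  by (rule simplicial_mapI[OF simplicial_set_W sset_A])
    (simp_all add: W_root root_tree_restr)

text \<open>\<open>T\<close> mixes trees of all dimensions and has no closure built in, so that the
  candidates form a complete lattice on which \<open>nxt\<close> can be iterated; closure under
  restriction is established separately.\<close>

definition W_in :: "('a, 'b) tree set \<Rightarrow> ('a, 'b) tree sset" where
  "W_in T = (W A B f)\<lparr>cells := (\<lambda>n. {w \<in> cells (W A B f) n. w \<in> T})\<rparr>"

lemma cells_W_in [simp]: "cells (W_in T) n = cells (W A B f) n \<inter> T"
  by (auto simp: W_in_def)

lemma restr_W_in [simp]: "restr (W_in T) = tree_restr A B f"
  by (simp add: W_in_def)

lemma root_map_W_in:
  assumes "\<And>m n \<theta> w. \<theta> \<in> Delta m n \<Longrightarrow> w \<in> cells (W A B f) n \<Longrightarrow> w \<in> T \<Longrightarrow>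
    tree_restr A B f m n \<theta> w \<in> T"
  shows "simplicial_map (W_in T) A (\<lambda>_. root)"
  unfolding W_in_def
proof (rule simplicial_map_sub[OF root_map], rule subcomplexI)
  show "restr (W A B f) m n \<theta> w \<in> {w \<in> cells (W A B f) m. w \<in> T}"
    if "\<theta> \<in> Delta m n" "w \<in> {w \<in> cells (W A B f) n. w \<in> T}" for m n \<theta> w
    using that assms tree_restr_in_W by simp
qed simp

text \<open>Inside \<open>W A B f\<close> this is the polynomial functor: if \<open>T\<close> is
  closed under restriction, \<open>W_in (nxt T)\<close> is the image of its value at
  \<open>W_in T\<close> under the algebra structure of the W-type.\<close>

definition nxt :: "('a, 'b) tree set \<Rightarrow> ('a, 'b) tree set" where
  "nxt T = {w. ran (branch w) \<subseteq> T}"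

lemma in_nxt_iff:
  assumes w: "w \<in> cells (W A B f) n"
  shows "w \<in> nxt T \<longleftrightarrow>
    (\<forall>m \<beta> b. (m, \<beta>, b) \<in> Bhat A B f n (root w) \<longrightarrow> child w m \<beta> b \<in> T)"
  using ran_branch[OF W_dom[OF w]] by (auto simp: nxt_def)

text \<open>Holds for every set \<open>T\<close>, since restricting a tree only selects some of its
  children.\<close>

lemma nxt_restr:
  assumes \<theta>: "\<theta> \<in> Delta m n" and w: "w \<in> cells (W A B f) n" "w \<in> nxt T"
  shows "tree_restr A B f m n \<theta> w \<in> nxt T"
  using w(2) Bhat_restr_left[OF W_root[OF w(1)] \<theta>] child_tree_restr
  by (simp add: in_nxt_iff[OF w(1)] in_nxt_iff[OF tree_restr_in_W[OF w(1) \<theta>]] root_tree_restr)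


section \<open>Horn fillings for trees\<close>

text \<open>A map from a subcomplex \<open>J\<close> of \<open>\<Delta>\<^sup>n\<close> to \<open>nxt T\<close> over \<open>v\<close> amounts to a map to \<open>T\<close> from
  the part of \<open>\<Delta>\<^sup>n \<times>\<^sub>A B\<close> over \<open>J\<close>, so that a lifting problem for \<open>nxt T\<close> becomes an
  extension problem for maps into the Kan complex \<open>T\<close>.\<close>

lemma kan_fibration_nxt:
  assumes A_kan: "kan_complex A" and f_kan: "kan_fibration B A f"
    and T: "kan_fibration (W_in T) A (\<lambda>_. root)"
  shows "kan_fibration (W_in (nxt T)) A (\<lambda>_. root)"
  unfolding kan_fibration_llp
proof (intro conjI allI impI)
  show "simplicial_map (W_in (nxt T)) A (\<lambda>_. root)"
    by (rule root_map_W_in[OF nxt_restr])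
  then have N: "simplicial_set (W_in (nxt T))" by (rule map_dom)
  have T_kan: "kan_fibration (W_in T) terminal_sset (\<lambda>_ _. ())"
    using kan_fibration_comp[OF T A_kan[unfolded kan_complex_def]] .
  then have T_set: "simplicial_set (W_in T)" by (auto simp: kan_fibration_def dest: map_dom)
  fix n k :: nat assume nk: "1 \<le> n" "k \<le> n"
  show "llp (simplex n) (cells (horn n k)) (W_in (nxt T)) A (\<lambda>_. root)"
  proof (rule llpI)
    fix u v
    assume u: "simplicial_map (simplex n\<lparr>cells := cells (horn n k)\<rparr>) (W_in (nxt T)) u"
      and v: "simplicial_map (simplex n) A v"
      and uv: "\<And>m \<theta>. \<theta> \<in> cells (horn n k) m \<Longrightarrow> root (u m \<theta>) = v m \<theta>"
    let ?E = "pullback (simplex n) B v f"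
    let ?L = "over ?E (cells (horn n k))"
    have E: "simplicial_set ?E" by (rule simplicial_set_pullback[OF v f])
    have L: "subcomplex ?E ?L" by (rule subcomplex_over[OF E subcomplex_horn])
    have v_cell: "v m \<theta> \<in> cells A m" if "\<theta> \<in> Delta m n" for m \<theta>
      using map_cell[OF v] that by simp
    have v_restr: "v l (compose {..l} \<theta> \<phi>) = restr A l m \<phi> (v m \<theta>)"
      if "\<phi> \<in> Delta l m" "\<theta> \<in> Delta m n" for l m \<phi> \<theta>
      using map_restr[OF v that(1), of \<theta>] that by simp
    have u_cell: "u m \<theta> \<in> cells (W A B f) m" "u m \<theta> \<in> nxt T" if "\<theta> \<in> cells (horn n k) m" for m \<theta>
      using map_cell[OF u, of \<theta> m] that by auto
    have u_restr: "u l (compose {..l} \<theta> \<phi>) = tree_restr A B f l m \<phi> (u m \<theta>)"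
      if "\<phi> \<in> Delta l m" "\<theta> \<in> cells (horn n k) m" for l m \<phi> \<theta>
      using map_restr[OF u that(1), of \<theta>] that(2) by simp
    have horn_Delta: "\<theta> \<in> Delta m n" if "\<theta> \<in> cells (horn n k) m" for m \<theta>
      using subcomplex_cell[OF subcomplex_horn that] by simp
    have horn_restr: "compose {..l} \<theta> \<phi> \<in> cells (horn n k) l"
      if "\<phi> \<in> Delta l m" "\<theta> \<in> cells (horn n k) m" for l m \<phi> \<theta>
      using subcomplex_restr[OF subcomplex_horn that] by simp
    \<comment> \<open>The child at \<open>\<beta>\<close> is the child at the identity of the tree
      restricted along \<open>\<beta>\<close>, so reading off only the children at identities loses
      nothing; \<open>g_child\<close> recovers the others.\<close>
    define g where "g m z = child (u m (fst z)) m (\<lambda>i\<in>{..m}. i) (snd z)" for m z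
    have id_Bhat: "(m, \<lambda>i\<in>{..m}. i, b) \<in> Bhat A B f m (root (u m \<theta>))" if "(\<theta>, b) \<in> ?L m" for m \<theta> b
      using that uv restr_id[OF sset_A v_cell] by (auto simp: over_def Bhat_iff)
    have g_child: "g l (compose {..l} \<theta> \<beta>, b) = child (u m \<theta>) l \<beta> b"
      if \<theta>: "\<theta> \<in> cells (horn n k) m" and \<beta>: "(l, \<beta>, b) \<in> Bhat A B f m (root (u m \<theta>))"
      for l m \<theta> \<beta> b
    proof -
      have \<beta>': "\<beta> \<in> Delta l m" using \<beta> by (simp add: Bhat_iff)
      have "(l, \<lambda>i\<in>{..l}. i, b) \<in> Bhat A B f l (restr A l m \<beta> (root (u m \<theta>)))"
        using \<beta> restr_id[OF sset_A restr_cell[OF sset_A \<beta>' W_root[OF u_cell(1)[OF \<theta>]]]]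
        by (simp add: Bhat_iff)
      from child_tree_restr[OF this] show ?thesis
        by (simp add: g_def u_restr[OF \<beta>' \<theta>] compose_Delta_id[OF \<beta>'])
    qed
    have g: "simplicial_map (?E\<lparr>cells := ?L\<rparr>) (W_in T) g"
    proof (rule simplicial_mapI[OF simplicial_set_sub[OF E L] T_set])
      fix m z assume "z \<in> cells (?E\<lparr>cells := ?L\<rparr>) m"
      then obtain \<theta> b where z: "z = (\<theta>, b)" "(\<theta>, b) \<in> ?L m" "\<theta> \<in> cells (horn n k) m"
        by (cases z) (auto simp: over_def)
      then show "g m z \<in> cells (W_in T) m"
        using W_child[OF u_cell(1) id_Bhat] in_nxt_iff[OF u_cell(1)] u_cell(2) id_Bhat
        by (simp add: g_def)
      fix l \<phi> assume \<phi>: "\<phi> \<in> Delta l m"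
      have "(l, \<phi>, restr B l m \<phi> b) \<in> Bhat A B f m (root (u m \<theta>))"
        using Bhat_restr_right[OF W_root[OF u_cell(1)[OF z(3)]] id_Bhat[OF z(2)] \<phi>]
        by (simp add: compose_id_Delta[OF \<phi>])
      from g_child[OF z(3) this]
      show "g l (restr (?E\<lparr>cells := ?L\<rparr>) l m \<phi> z) = restr (W_in T) l m \<phi> (g m z)"
        using W_child_restr[OF u_cell(1)[OF z(3)] id_Bhat[OF z(2)] \<phi>] z(1)
        by (simp add: g_def compose_id_Delta[OF \<phi>])
    qed
    obtain h where h: "simplicial_map ?E (W_in T) h" "\<And>m z. z \<in> ?L m \<Longrightarrow> h m z = g m z"
      by (rule llpE[OF llp_pullback_horn[OF nk f_kan v T_kan] g terminal_map[OF E]]) auto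
    have h_cell: "h m z \<in> cells (W A B f) m" "h m z \<in> T" if "z \<in> cells ?E m" for m z
      using map_cell[OF h(1) that] by auto
    define w where "w m \<theta> = Node m (v m \<theta>)
        ((\<lambda>(l, \<beta>, b). Some (h l (compose {..l} \<theta> \<beta>, b))) |` Bhat A B f m (v m \<theta>))" for m \<theta>
    have w_child: "child (w m \<theta>) l \<beta> b = h l (compose {..l} \<theta> \<beta>, b)"
      if "(l, \<beta>, b) \<in> Bhat A B f m (v m \<theta>)" for l m \<theta> \<beta> b
      using that by (simp add: w_def)
    have w_root: "root (w m \<theta>) = v m \<theta>" for m \<theta> by (simp add: w_def)
    have in_E: "(compose {..l} \<theta> \<beta>, b) \<in> cells ?E l"
      if "\<theta> \<in> Delta m n" "(l, \<beta>, b) \<in> Bhat A B f m (v m \<theta>)" for l m \<theta> \<beta> b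
      using that v_restr[of \<beta> l m \<theta>] Delta_compose[of \<beta> l m \<theta> n] by (simp add: Bhat_iff)
    have w_W: "w m \<theta> \<in> cells (W A B f) m" if \<theta>: "\<theta> \<in> Delta m n" for m \<theta>
    proof -
      have "natural A B f (w m \<theta>)"
        unfolding natural_def
      proof (intro ballI, clarify, intro conjI allI ballI)
        fix l \<beta> b assume "(l, \<beta>, b) \<in> Bhat A B f (fibre (w m \<theta>)) (root (w m \<theta>))"
        then have i: "(l, \<beta>, b) \<in> Bhat A B f m (v m \<theta>)" by (simp add: w_def)
        show "fibre (child (w m \<theta>) l \<beta> b) = l"
          using w_child[OF i] fibre_W[OF h_cell(1)[OF in_E[OF \<theta> i]]] by simp
        fix j \<delta> assume \<delta>: "\<delta> \<in> Delta j l"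
        have "\<beta> \<in> Delta l m" using i by (simp add: Bhat_iff)
        then show "child (w m \<theta>) j (compose {..j} \<beta> \<delta>) (restr B j l \<delta> b) =
            tree_restr A B f j l \<delta> (child (w m \<theta>) l \<beta> b)"
          using w_child[OF i] w_child[OF Bhat_restr_right[OF v_cell[OF \<theta>] i \<delta>]]
            map_restr[OF h(1) \<delta> in_E[OF \<theta> i]] compose_Delta_assoc[OF \<delta>, of \<beta> m \<theta>]
          by simp
      qed
      moreover have "h l (compose {..l} \<theta> \<beta>, b) \<in> cells (W A B f) l"
        if "(l, \<beta>, b) \<in> Bhat A B f m (v m \<theta>)" for l \<beta> b
        by (rule h_cell(1)[OF in_E[OF \<theta> that]])
      moreover have "dom ((\<lambda>(l, \<beta>, b). Some (h l (compose {..l} \<theta> \<beta>, b))) |` S) = S" for S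
        by (auto simp: dom_def restrict_map_def)
      ultimately show ?thesis
        unfolding w_def Node_in_W_iff using v_cell[OF \<theta>] by simp
    qed
    have w_nxt: "w m \<theta> \<in> nxt T" if \<theta>: "\<theta> \<in> Delta m n" for m \<theta>
      unfolding in_nxt_iff[OF w_W[OF \<theta>]] w_root
      using w_child h_cell(2)[OF in_E[OF \<theta>]] by simp
    have "simplicial_map (simplex n) (W_in (nxt T)) w"
    proof (rule simplicial_mapI[OF simplicial_set_simplex N])
      show "w m \<theta> \<in> cells (W_in (nxt T)) m" if "\<theta> \<in> cells (simplex n) m" for m \<theta>
        using w_W w_nxt that by simp
      fix l m \<phi> \<theta> assume \<phi>: "\<phi> \<in> Delta l m" and "\<theta> \<in> cells (simplex n) m"
      then have \<theta>: "\<theta> \<in> Delta m n" by simp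
      have "w l (compose {..l} \<theta> \<phi>) = tree_restr A B f l m \<phi> (w m \<theta>)"
      proof (rule W_eqI[OF w_W[OF Delta_compose[OF \<phi> \<theta>]] tree_restr_in_W[OF w_W[OF \<theta>] \<phi>]])
        show "root (w l (compose {..l} \<theta> \<phi>)) = root (tree_restr A B f l m \<phi> (w m \<theta>))"
          by (simp add: w_root root_tree_restr v_restr[OF \<phi> \<theta>])
        fix j \<beta> b assume "(j, \<beta>, b) \<in> Bhat A B f l (root (w l (compose {..l} \<theta> \<phi>)))"
        then have i: "(j, \<beta>, b) \<in> Bhat A B f l (v l (compose {..l} \<theta> \<phi>))"
          by (simp add: w_root)
        then have i': "(j, \<beta>, b) \<in> Bhat A B f l (restr A l m \<phi> (root (w m \<theta>)))"
          by (simp add: w_root v_restr[OF \<phi> \<theta>])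
        then have \<beta>: "\<beta> \<in> Delta j l" "(j, compose {..j} \<phi> \<beta>, b) \<in> Bhat A B f m (v m \<theta>)"
          using Bhat_restr_left[OF v_cell[OF \<theta>] \<phi>] by (auto simp: w_root)
        show "child (w l (compose {..l} \<theta> \<phi>)) j \<beta> b =
            child (tree_restr A B f l m \<phi> (w m \<theta>)) j \<beta> b"
          using w_child[OF i] child_tree_restr[OF i'] w_child[OF \<beta>(2)]
            compose_Delta_assoc[OF \<beta>(1) \<phi>, of \<theta>] by simp
      qed
      then show "w l (restr (simplex n) l m \<phi> \<theta>) = restr (W_in (nxt T)) l m \<phi> (w m \<theta>)" by simp
    qed
    moreover have "w m \<theta> = u m \<theta>" if \<theta>: "\<theta> \<in> cells (horn n k) m" for m \<theta>
    proof (rule W_eqI[OF w_W[OF horn_Delta[OF \<theta>]] u_cell(1)[OF \<theta>]])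
      show "root (w m \<theta>) = root (u m \<theta>)" using uv[OF \<theta>] by (simp add: w_root)
      fix l \<beta> b assume "(l, \<beta>, b) \<in> Bhat A B f m (root (w m \<theta>))"
      then have i: "(l, \<beta>, b) \<in> Bhat A B f m (v m \<theta>)" by (simp add: w_root)
      have "(compose {..l} \<theta> \<beta>, b) \<in> ?L l"
        using in_E[OF horn_Delta[OF \<theta>] i] horn_restr[OF _ \<theta>] i by (simp add: over_def Bhat_iff)
      then show "child (w m \<theta>) l \<beta> b = child (u m \<theta>) l \<beta> b"
        using w_child[OF i] h(2) g_child[OF \<theta>] i uv[OF \<theta>] by simp
    qed
    ultimately show "\<exists>w. simplicial_map (simplex n) (W_in (nxt T)) w \<and>
        (\<forall>m. \<forall>\<theta>\<in>cells (horn n k) m. w m \<theta> = u m \<theta>) \<and>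
        (\<forall>m. \<forall>\<theta>\<in>cells (simplex n) m. root (w m \<theta>) = v m \<theta>)"
      using w_root by (intro exI[of _ w]) simp
  qed
qed

text \<open>A horn has finitely many faces, so a map from it to the union of a chain factors
  through a member of the chain.\<close>

lemma kan_fibration_Union:
  assumes chain: "Complete_Partial_Order.chain (\<le>) F"
    and F: "\<And>T. T \<in> F \<Longrightarrow> kan_fibration (W_in T) A (\<lambda>_. root)"
  shows "kan_fibration (W_in (\<Union>F)) A (\<lambda>_. root)"
  unfolding kan_fibration_llp
proof (intro conjI allI impI)
  have restr: "tree_restr A B f m n \<theta> w \<in> T"
    if "T \<in> F" "\<theta> \<in> Delta m n" "w \<in> cells (W A B f) n" "w \<in> T" for T m n \<theta> w
  proof -
    have "simplicial_set (W_in T)" using F[OF that(1)] by (auto simp: kan_fibration_def dest: map_dom)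
    from restr_cell[OF this that(2), of w] show ?thesis using that by simp
  qed
  show "simplicial_map (W_in (\<Union>F)) A (\<lambda>_. root)"
    by (rule root_map_W_in) (use restr in blast)
  then have U: "simplicial_set (W_in (\<Union>F))" by (rule map_dom)
  fix n k :: nat assume nk: "1 \<le> n" "k \<le> n"
  show "llp (simplex n) (cells (horn n k)) (W_in (\<Union>F)) A (\<lambda>_. root)"
  proof (rule llpI)
    fix u v
    assume u: "simplicial_map (simplex n\<lparr>cells := cells (horn n k)\<rparr>) (W_in (\<Union>F)) u"
      and v: "simplicial_map (simplex n) A v"
      and uv: "\<And>m \<theta>. \<theta> \<in> cells (horn n k) m \<Longrightarrow> root (u m \<theta>) = v m \<theta>"
    obtain n' where n: "n = Suc n'" using nk(1) by (cases n) auto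
    define P where "P = (\<lambda>j. u n' (face n' j)) ` ({..n} - {k})"
    have face: "face n' j \<in> cells (horn n k) n'" if "j \<le> n" "j \<noteq> k" for j
      using face_Delta[of n' j] face_omits[of j n'] that n by (auto simp: cells_horn)
    have PU: "P \<subseteq> \<Union>F" using map_cell[OF u] face by (auto simp: P_def)
    \<comment> \<open>As \<open>n\<close> is positive, some vertex differs from \<open>k\<close> and
      the horn has a face. So \<open>F\<close> is nonempty: for the empty chain there is no horn to
      fill.\<close>
    have "(if k = 0 then 1 else 0) \<in> {..n} - {k}" using nk by auto
    then have "P \<noteq> {}" unfolding P_def by blast
    with PU have "F \<noteq> {}" by blast
    moreover have "subset.chain UNIV F"
      using chain by (auto simp: subset_chain_def Complete_Partial_Order.chain_def)
    moreover have "finite P" by (simp add: P_def)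
    ultimately obtain T where T: "T \<in> F" "P \<subseteq> T"
      using finite_subset_Union_chain PU by metis
    have T_kan: "kan_fibration (W_in T) A (\<lambda>_. root)" by (rule F[OF T(1)])
    then have T_set: "simplicial_set (W_in T)" by (auto simp: kan_fibration_def dest: map_dom)
    have uT: "u m \<theta> \<in> T" if \<theta>_horn: "\<theta> \<in> cells (horn n k) m" for m \<theta>
    proof -
      obtain j where j: "j \<le> n" "j \<noteq> k" "j \<notin> \<theta> ` {..m}" and \<theta>: "\<theta> \<in> Delta m n"
        using \<theta>_horn by (auto simp: cells_horn)
      obtain n'' \<phi> where "n = Suc n''" and \<phi>: "\<phi> \<in> Delta m n''" and "\<theta> = compose {..m} (face n'' j) \<phi>"
        by (rule Delta_factor_face[OF \<theta> j(1,3)])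
      then have \<phi>: "\<phi> \<in> Delta m n'" "\<theta> = compose {..m} (face n' j) \<phi>" using n by auto
      have "u n' (face n' j) \<in> T" using T(2) j by (auto simp: P_def)
      moreover have "u n' (face n' j) \<in> cells (W A B f) n'"
        using map_cell[OF u] face j by auto
      ultimately show ?thesis
        using map_restr[OF u \<phi>(1), of "face n' j"] face j \<phi>(2) restr[OF T(1) \<phi>(1)] by simp
    qed
    have uT': "simplicial_map (simplex n\<lparr>cells := cells (horn n k)\<rparr>) (W_in T) u"
      by (rule simplicial_mapI[OF map_dom[OF u] T_set])
        (use map_cell[OF u] map_restr[OF u] uT in auto)
    have "llp (simplex n) (cells (horn n k)) (W_in T) A (\<lambda>_. root)"
      using T_kan nk by (simp add: kan_fibration_llp)
    then obtain w where w: "simplicial_map (simplex n) (W_in T) w"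
      "\<And>m \<theta>. \<theta> \<in> cells (horn n k) m \<Longrightarrow> w m \<theta> = u m \<theta>"
      "\<And>m \<theta>. \<theta> \<in> cells (simplex n) m \<Longrightarrow> root (w m \<theta>) = v m \<theta>"
      by (rule llpE[OF _ uT' v]) (use uv in auto)
    have "simplicial_map (simplex n) (W_in (\<Union>F)) w"
      by (rule simplicial_mapI[OF simplicial_set_simplex U])
        (use map_cell[OF w(1)] map_restr[OF w(1)] T(1) in auto)
    then show "\<exists>w. simplicial_map (simplex n) (W_in (\<Union>F)) w \<and>
        (\<forall>m. \<forall>\<theta>\<in>cells (horn n k) m. w m \<theta> = u m \<theta>) \<and>
        (\<forall>m. \<forall>\<theta>\<in>cells (simplex n) m. root (w m \<theta>) = v m \<theta>)"
      using w(2,3) by blast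
  qed
qed

section \<open>Iterating \<open>nxt\<close>\<close>

lemma mono_nxt: "monotone (\<le>) (\<le>) nxt"
  by (rule monotoneI) (auto simp: nxt_def)

text \<open>The iterates are generated by \<open>nxt\<close> and unions of chains; the empty chain
  supplies the base case, the empty set of trees.\<close>

lemma kan_fibration_iterates:
  assumes "kan_complex A" "kan_fibration B A f" "T \<in> ccpo_class.iterates nxt"
  shows "kan_fibration (W_in T) A (\<lambda>_. root)"
  using assms(3)
proof (induction rule: ccpo_class.iterates.induct)
  case (step T)
  then show ?case using kan_fibration_nxt assms(1,2) by blast
next
  case (Sup F)
  then show ?case using kan_fibration_Union by blast
qed

text \<open>The least fixed point of \<open>nxt\<close> is itself an iterate, and it contains every
  well-founded tree by induction. This reaches all of \<open>W A B f\<close> without an ordinal that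
  bounds the ranks.\<close>

lemma W_eq_W_in_fixp: "W A B f = W_in (ccpo_class.fixp nxt)"
proof -
  let ?T = "ccpo_class.fixp nxt"
  have "w \<in> ?T" if "w \<in> What A B f" for w
    using that
  proof (induction rule: What.induct)
    case (1 a n t)
    then have "Node n a t \<in> nxt ?T" by (subst nxt_def) auto
    then show ?case using fixp_unfold[OF mono_nxt] by blast
  qed
  then have "cells (W_in ?T) = cells (W A B f)"
    by (auto simp: fun_eq_iff W_def)
  then show ?thesis by (simp add: W_in_def)
qed

definition rank_less :: "'o::wellorder \<Rightarrow> ('a, 'b) tree set" where
  "rank_less \<alpha> = {w. \<exists>\<rho>. rank w = Some \<rho> \<and> \<rho> < \<alpha>}"

lemma W_less_eq: "W_less A B f \<alpha> = W_in (rank_less \<alpha>)"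
  by (simp add: W_less_def W_in_def rank_less_def)

end

section \<open>Ranks of trees\<close>

lemma ord_sup_le:
  assumes "\<And>r. r \<in> S \<Longrightarrow> \<exists>y\<le>x. r = Some y"
  shows "\<exists>z\<le>x. ord_sup S = Some z"
  using assms Least_le[of "\<lambda>x. \<forall>r \<in> S. \<exists>y \<le> x. r = Some y" x] by (auto simp: ord_sup_def)

lemma ord_sup_upper:
  assumes "ord_sup S = Some z" "r \<in> S"
  shows "\<exists>y\<le>z. r = Some y"
proof -
  let ?P = "\<lambda>x. \<forall>r \<in> S. \<exists>y \<le> x. r = Some y"
  have ex: "\<exists>x. ?P x" and z: "z = Least ?P"
    using assms(1) by (auto simp: ord_sup_def split: if_splits)
  have "?P z" unfolding z by (rule LeastI_ex[OF ex])
  then show ?thesis using assms(2) by blast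
qed

text \<open>\<open>None\<close> and a greatest element of \<open>'o\<close> have no successor in
  \<open>'o\<close>, and for them both sides fail; so the truncation at \<open>None\<close> does not
  disturb comparisons with elements of \<open>'o\<close>.\<close>

lemma ord_succ_le_iff: "(\<exists>y\<le>\<beta>. ord_succ r = Some y) \<longleftrightarrow> (\<exists>x<\<beta>. r = Some x)"
proof
  assume "\<exists>y\<le>\<beta>. ord_succ r = Some y"
  then obtain x y where x: "r = Some x" "\<exists>y. x < y" "y = (LEAST y. x < y)" "y \<le> \<beta>"
    by (auto simp: ord_succ_def split: option.splits if_splits)
  then have "x < y" by (auto intro: LeastI_ex)
  with x show "\<exists>x<\<beta>. r = Some x" by auto
next
  assume "\<exists>x<\<beta>. r = Some x"
  then show "\<exists>y\<le>\<beta>. ord_succ r = Some y"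
    by (auto simp: ord_succ_def intro: Least_le)
qed

lemma rank_branch: "(rank w :: 'o::wellorder option) = ord_sup (ord_succ ` rank ` ran (branch w))"
proof (cases w)
  case (Node n a t)
  have "ran (map_option (rank :: _ \<Rightarrow> 'o option) \<circ> t) = rank ` ran t"
    by (force simp: ran_def image_iff)
  then show ?thesis using Node by simp
qed

context W_type
begin

text \<open>A tree has rank at most \<open>\<beta>\<close> exactly when all its children have rank
  below \<open>\<beta>\<close>; from left to right, \<open>\<beta>\<close> is the rank itself. For
  the least \<open>\<alpha>\<close> both sides are empty.\<close>

lemma rank_less_eq: "rank_less \<alpha> = (\<Union>\<beta>\<in>{..<\<alpha>}. nxt (rank_less \<beta>))"
proof (intro equalityI subsetI)
  fix w assume "w \<in> rank_less \<alpha>"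
  then obtain \<beta> where \<beta>: "rank w = Some \<beta>" "\<beta> < \<alpha>" by (auto simp: rank_less_def)
  have "\<exists>\<sigma><\<beta>. rank u = Some \<sigma>" if "u \<in> ran (branch w)" for u
    using ord_sup_upper[OF \<beta>(1)[unfolded rank_branch[of w]]] that ord_succ_le_iff by blast
  then have "w \<in> nxt (rank_less \<beta>)" by (auto simp: nxt_def rank_less_def)
  then show "w \<in> (\<Union>\<beta>\<in>{..<\<alpha>}. nxt (rank_less \<beta>))" using \<beta>(2) by blast
next
  fix w assume "w \<in> (\<Union>\<beta>\<in>{..<\<alpha>}. nxt (rank_less \<beta>))"
  then obtain \<beta> where \<beta>: "\<beta> < \<alpha>" "w \<in> nxt (rank_less \<beta>)" by blast
  then have "\<exists>\<sigma><\<beta>. rank u = Some \<sigma>" if "u \<in> ran (branch w)" for u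
    using that unfolding nxt_def rank_less_def by blast
  then have "\<exists>z\<le>\<beta>. rank w = Some z"
    unfolding rank_branch[of w] by (intro ord_sup_le) (auto simp: ord_succ_le_iff)
  then show "w \<in> rank_less \<alpha>" using \<beta>(1) by (auto simp: rank_less_def)
qed

text \<open>The union over all smaller \<open>\<beta>\<close> treats zero, successors and limits
  alike. It is a union of a chain because any two iterates of a monotone operator are
  comparable.\<close>

lemma rank_less_iterates: "rank_less \<alpha> \<in> ccpo_class.iterates nxt"
proof (induction \<alpha> rule: less_induct)
  case (less \<alpha>)
  let ?F = "(\<lambda>\<beta>. nxt (rank_less \<beta>)) ` {..<\<alpha>}"
  have F: "T \<in> ccpo_class.iterates nxt" if "T \<in> ?F" for T
    using that less by (auto intro: ccpo_class.iterates.step)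
  have "Complete_Partial_Order.chain (\<le>) ?F"
    using chain_subset[OF chain_iterates[OF mono_nxt]] F by blast
  then have "\<Union>?F \<in> ccpo_class.iterates nxt"
    using F by (blast intro: ccpo_class.iterates.Sup)
  then show ?case using rank_less_eq by metis
qed

end

theorem theorem3p4:
  fixes A :: "'a sset" and B :: "'b sset" and f :: "nat \<Rightarrow> 'b \<Rightarrow> 'a"
  assumes "kan_complex A" and "kan_complex B" and "kan_fibration B A f"
  shows "(\<forall>\<alpha>::'o::wellorder. kan_fibration (W_less A B f \<alpha>) A (\<lambda>_. root)) \<and>
         kan_fibration (W A B f) A (\<lambda>_. root)"
proof -
  interpret W_type A B f
    by unfold_locales (use assms(3) in \<open>simp add: kan_fibration_def\<close>)
  show ?thesis
    unfolding W_less_eq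
  proof (intro conjI allI)
    show "kan_fibration (W_in (rank_less \<alpha>)) A (\<lambda>_. root)" for \<alpha> :: 'o
      by (rule kan_fibration_iterates[OF assms(1,3) rank_less_iterates])
    show "kan_fibration (W A B f) A (\<lambda>_. root)"
      by (subst W_eq_W_in_fixp)
        (rule kan_fibration_iterates[OF assms(1,3) iterates_fixp[OF mono_nxt]])
  qed
qed

end
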